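(* Let $M$ be a $C^1$ Finsler manifold modeled on a Banach space that admits a $C^1$ Lipschitz bump function. Let $f\colon M\to\mathbb{R}$ be a lower semicontinuous function such that $\|\xi\|_x\le K$ for every $x\in M$ and every $\xi\in D^-f(x)$. Then $f$ is $K$-Lipschitz with respect to the Finsler metric $d$ of $M$, that is, $|f(y)-f(z)|\le K\,d(y,z)$ for all $y,z\in M$.
   Context: $C^1$ Finsler manifold (in the sense of Palais): a connected, paracompact $C^1$ Banach manifold $M$ modeled on a Banach space $(X,\|\cdot\|)$, with a continuous map $\|\cdot\|_M:TM\to[0,\infty)$ such that: (P1) for every $x\in M$ the restriction $\|\cdot\|_x$ of $\|\cdot\|_M$ to $T_xM$ is a norm such that for every chart $\varphi:U\to X$ with $x\in U$, the norm $v\in X\mapsto\|d\varphi^{-1}(\varphi(x))(v)\|_x$ is equivalent to $\|\cdot\|$; (P2) for every $x_0\in M$, $\varepsilon>0$ and chart $\varphi:U\to X$ with $x_0\in U$ there is an open neighborhood $W$ of $x_0$ such that for all $x\in W$, $v\in X$, $\frac{1}{1+\varepsilon}\|d\varphi^{-1}(\varphi(x_0))(v)\|_{x_0}\le\|d\varphi^{-1}(\varphi(x))(v)\|_x\le(1+\varepsilon)\|d\varphi^{-1}(\varphi(x_0))(v)\|_{x_0}$. Finsler metric: $d(p,q)$ is the infimum of the lengths $\ell(c)=\int_a^b\|c'(t)\|_{c(t)}\,dt$ over piecewise $C^1$ paths $c:[a,b]\to M$ connecting $p$ to $q$. $C^1$ Lipschitz bump function on $X$: a $C^1$, Lipschitz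 function $b:X\to\mathbb{R}$ with bounded, non-empty support. Subdifferential: $D^-f(x)=\{dg(x): g:M\to\mathbb{R}\text{ is }C^1\text{ and }f-g\text{ attains a local minimum at }x\}\subset T_xM^*$. For $\xi\in T_xM^*$, $\|\xi\|_x$ denotes the dual norm $\sup\{|\xi(v)|:v\in T_xM,\ \|v\|_x=1\}$. *)

theory Defs
  imports "HOL-Analysis.Analysis"
begin

section \<open>Topological and differential preliminaries\<close>

text \<open>The Hausdorff property, which is often made part of paracompactness, is supplied below by
  the sort \<open>t2_space\<close> of the manifold.\<close>

definition paracompact_space :: "'a topology \<Rightarrow> bool" where
  "paracompact_space T \<longleftrightarrow>
     (\<forall>\<C>. (\<forall>C\<in>\<C>. openin T C) \<and> \<Union>\<C> = topspace T \<longrightarrow>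
       (\<exists>\<D>. (\<forall>D\<in>\<D>. openin T D) \<and> \<Union>\<D> = topspace T \<and>
            (\<forall>D\<in>\<D>. \<exists>C\<in>\<C>. D \<subseteq> C) \<and> locally_finite_in T \<D>))"

definition lower_semicontinuous :: "('a::topological_space \<Rightarrow> real) \<Rightarrow> bool" where
  "lower_semicontinuous f \<longleftrightarrow> (\<forall>x. \<forall>a < f x. \<forall>\<^sub>F y in nhds x. a < f y)"

definition C1_on ::
    "'a::real_normed_vector set \<Rightarrow> ('a \<Rightarrow> 'b::real_normed_vector) \<Rightarrow> bool" where
  "C1_on S f \<longleftrightarrow>
     (\<exists>f' :: 'a \<Rightarrow> 'a \<Rightarrow>\<^sub>L 'b.
        (\<forall>x\<in>S. (f has_derivative blinfun_apply (f' x)) (at x)) \<and> continuous_on S f')"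

definition C1_Lipschitz_bump :: "('x::real_normed_vector \<Rightarrow> real) \<Rightarrow> bool" where
  "C1_Lipschitz_bump b \<longleftrightarrow>
     C1_on UNIV b \<and> (\<exists>L. L-lipschitz_on UNIV b) \<and>
     bounded (closure {x. b x \<noteq> 0}) \<and> closure {x. b x \<noteq> 0} \<noteq> {}"


section \<open>\<open>C\<^sup>1\<close> Banach manifolds\<close>

text \<open>A chart is a pair \<open>(U, \<phi>)\<close>; only the values of \<open>\<phi>\<close> on \<open>U\<close> matter. Charts with the same
  domain and the same values there count as different elements of an atlas, which is harmless since
  all the conditions below depend on \<open>\<phi>\<close> only through its restriction to \<open>U\<close>.\<close>

type_synonym ('m, 'x) chart = "'m set \<times> ('m \<Rightarrow> 'x)"

abbreviation chart_inv :: "('m, 'x) chart \<Rightarrow> 'x \<Rightarrow> 'm" where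
  "chart_inv c \<equiv> inv_into (fst c) (snd c)"

definition is_chart :: "('m::topological_space, 'x::real_normed_vector) chart \<Rightarrow> bool" where
  "is_chart c \<longleftrightarrow> open (fst c) \<and> open (snd c ` fst c) \<and>
     homeomorphism (fst c) (snd c ` fst c) (snd c) (chart_inv c)"

definition C1_compatible ::
    "('m::topological_space, 'x::real_normed_vector) chart \<Rightarrow> ('m, 'x) chart \<Rightarrow> bool" where
  "C1_compatible c c' \<longleftrightarrow>
     C1_on (snd c ` (fst c \<inter> fst c')) (snd c' \<circ> chart_inv c) \<and>
     C1_on (snd c' ` (fst c \<inter> fst c')) (snd c \<circ> chart_inv c')"

text \<open>The differentiable structure is given by its maximal atlas \<open>A\<close>, so that \<open>c \<in> A\<close> reads
  ``\<open>c\<close> is a chart of the manifold''.\<close>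

locale C1_Banach_manifold =
  fixes A :: "('m::t2_space, 'x::banach) chart set"
  assumes charts: "c \<in> A \<Longrightarrow> is_chart c"
    and cover: "(\<Union>c\<in>A. fst c) = UNIV"
    and compatible: "c \<in> A \<Longrightarrow> c' \<in> A \<Longrightarrow> C1_compatible c c'"
    and maximal: "is_chart c \<Longrightarrow> (\<And>c'. c' \<in> A \<Longrightarrow> C1_compatible c c') \<Longrightarrow> c \<in> A"


section \<open>Tangent bundle\<close>

text \<open>A tangent vector at \<open>x\<close> is a class of pairs (chart at \<open>x\<close>, vector of the model space), two
  pairs being identified when the derivative of the transition map takes one vector to the other.
  Such a class is the graph of a function from the charts at \<open>x\<close> to the model space, and this
  function, extended by 0, is taken as the tangent vector; \<open>u c\<close> is then the coordinate vector of
  \<open>u\<close> in the chart \<open>c\<close>, and the linear operations are pointwise.\<close>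

type_synonym ('m, 'x) tvec = "('m, 'x) chart \<Rightarrow> 'x"

definition tangent_space ::
    "('m, 'x::real_normed_vector) chart set \<Rightarrow> 'm \<Rightarrow> ('m, 'x) tvec set" where
  "tangent_space A x =
     {u. (\<forall>c. \<not> (c \<in> A \<and> x \<in> fst c) \<longrightarrow> u c = 0) \<and>
         (\<forall>c\<in>A. \<forall>c'\<in>A. x \<in> fst c \<longrightarrow> x \<in> fst c' \<longrightarrow>
            u c' = frechet_derivative (snd c' \<circ> chart_inv c) (at (snd c x)) (u c))}"

definition tangent_bundle ::
    "('m, 'x::real_normed_vector) chart set \<Rightarrow> ('m \<times> ('m, 'x) tvec) set" where
  "tangent_bundle A = (SIGMA x:UNIV. tangent_space A x)"

text \<open>The topology for which the bundle charts \<open>(x, u) \<mapsto> (\<phi> x, u (U, \<phi>))\<close>, \<open>(U, \<phi>) \<in> A\<close>, are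
  homeomorphisms onto \<open>\<phi> ` U \<times> X\<close>.\<close>

definition tangent_bundle_topology ::
    "('m, 'x::real_normed_vector) chart set \<Rightarrow> ('m \<times> ('m, 'x) tvec) topology" where
  "tangent_bundle_topology A = topology_generated_by
     {{(x, u) \<in> tangent_bundle A. x \<in> fst c \<and> (snd c x, u c) \<in> W} | c W. c \<in> A \<and> open W}"

text \<open>The differential at \<open>p\<close> of a map \<open>h\<close> from a normed space into the manifold, applied to \<open>v\<close>:
  its coordinate vector in the chart \<open>c\<close> is the derivative of \<open>c \<circ> h\<close> at \<open>p\<close> in direction \<open>v\<close>.\<close>

definition differential_into ::
    "('m, 'x::real_normed_vector) chart set \<Rightarrow> ('e::real_normed_vector \<Rightarrow> 'm) \<Rightarrow> 'e \<Rightarrow> 'e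
      \<Rightarrow> ('m, 'x) tvec" where
  "differential_into A h p v =
     (\<lambda>c. if c \<in> A \<and> h p \<in> fst c then frechet_derivative (snd c \<circ> h) (at p) v else 0)"


section \<open>\<open>C\<^sup>1\<close> Finsler manifolds in the sense of Palais\<close>

text \<open>\<open>N x u\<close> is the norm of the tangent vector \<open>u\<close> at \<open>x\<close>; only its values on the tangent bundle
  are constrained or used.\<close>

definition is_norm_on_tangent_space ::
    "('m, 'x::real_normed_vector) chart set \<Rightarrow> 'm \<Rightarrow> (('m, 'x) tvec \<Rightarrow> real) \<Rightarrow> bool" where
  "is_norm_on_tangent_space A x n \<longleftrightarrow>
     (\<forall>u\<in>tangent_space A x. 0 \<le> n u \<and> (n u = 0 \<longleftrightarrow> u = (\<lambda>_. 0))) \<and>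
     (\<forall>u\<in>tangent_space A x. \<forall>w\<in>tangent_space A x. n (\<lambda>c. u c + w c) \<le> n u + n w) \<and>
     (\<forall>u\<in>tangent_space A x. \<forall>r. n (\<lambda>c. r *\<^sub>R u c) = \<bar>r\<bar> * n u)"

definition equivalent_to_norm :: "('x::real_normed_vector \<Rightarrow> real) \<Rightarrow> bool" where
  "equivalent_to_norm n \<longleftrightarrow>
     (\<exists>a>0. \<exists>b>0. \<forall>v. a * norm v \<le> n v \<and> n v \<le> b * norm v)"

locale C1_Finsler_manifold = C1_Banach_manifold A
  for A :: "('m::t2_space, 'x::banach) chart set" +
  fixes N :: "'m \<Rightarrow> ('m, 'x) tvec \<Rightarrow> real"
  assumes connected: "connected (UNIV :: 'm set)"
    and paracompact: "paracompact_space (euclidean :: 'm topology)"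
    and continuous:
      "continuous_map (tangent_bundle_topology A) euclideanreal (\<lambda>(x, u). N x u)"
    and P1_norm: "is_norm_on_tangent_space A x (N x)"
    and P1_equivalent: "c \<in> A \<Longrightarrow> x \<in> fst c \<Longrightarrow>
      equivalent_to_norm (\<lambda>v. N x (differential_into A (chart_inv c) (snd c x) v))"
    and P2: "0 < \<epsilon> \<Longrightarrow> c \<in> A \<Longrightarrow> x\<^sub>0 \<in> fst c \<Longrightarrow>
      \<exists>W. open W \<and> x\<^sub>0 \<in> W \<and> W \<subseteq> fst c \<and> (\<forall>x\<in>W. \<forall>v.
        1 / (1 + \<epsilon>) * N x\<^sub>0 (differential_into A (chart_inv c) (snd c x\<^sub>0) v)
          \<le> N x (differential_into A (chart_inv c) (snd c x) v) \<and>
        N x (differential_into A (chart_inv c) (snd c x) v)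
          \<le> (1 + \<epsilon>) * N x\<^sub>0 (differential_into A (chart_inv c) (snd c x\<^sub>0) v))"


section \<open>Finsler metric\<close>

definition C1_path_on ::
    "('m::topological_space, 'x::real_normed_vector) chart set \<Rightarrow> real \<Rightarrow> real \<Rightarrow> (real \<Rightarrow> 'm)
      \<Rightarrow> bool" where
  "C1_path_on A a b \<gamma> \<longleftrightarrow> continuous_on {a..b} \<gamma> \<and>
     (\<forall>c\<in>A. \<exists>D. continuous_on {t \<in> {a..b}. \<gamma> t \<in> fst c} D \<and>
        (\<forall>t\<in>{a..b}. \<gamma> t \<in> fst c \<longrightarrow>
           (snd c \<circ> \<gamma> has_vector_derivative D t) (at t within {a..b})))"

definition piecewise_C1_path_on ::
    "('m::topological_space, 'x::real_normed_vector) chart set \<Rightarrow> real \<Rightarrow> real \<Rightarrow> (real \<Rightarrow> 'm)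
      \<Rightarrow> bool" where
  "piecewise_C1_path_on A a b \<gamma> \<longleftrightarrow>
     (\<exists>(n::nat) s. s 0 = a \<and> s n = b \<and>
        (\<forall>i<n. s i < s (Suc i) \<and> C1_path_on A (s i) (s (Suc i)) \<gamma>))"

text \<open>The integrand is arbitrary at the finitely many \<open>t\<close> where the path is not differentiable,
  which does not affect the integral.\<close>

definition path_len ::
    "('m, 'x::real_normed_vector) chart set \<Rightarrow> ('m \<Rightarrow> ('m, 'x) tvec \<Rightarrow> real)
      \<Rightarrow> real \<Rightarrow> real \<Rightarrow> (real \<Rightarrow> 'm) \<Rightarrow> real" where
  "path_len A N a b \<gamma> = integral {a..b} (\<lambda>t. N (\<gamma> t) (differential_into A \<gamma> t 1))"

definition finsler_dist ::
    "('m::topological_space, 'x::real_normed_vector) chart set \<Rightarrow> ('m \<Rightarrow> ('m, 'x) tvec \<Rightarrow> real)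
      \<Rightarrow> 'm \<Rightarrow> 'm \<Rightarrow> real" where
  "finsler_dist A N p q =
     Inf {path_len A N a b \<gamma> | a b \<gamma>.
            a < b \<and> piecewise_C1_path_on A a b \<gamma> \<and> \<gamma> a = p \<and> \<gamma> b = q}"


section \<open>Subdifferential\<close>

definition C1_function ::
    "('m, 'x::real_normed_vector) chart set \<Rightarrow> ('m \<Rightarrow> real) \<Rightarrow> bool" where
  "C1_function A g \<longleftrightarrow> (\<forall>c\<in>A. C1_on (snd c ` fst c) (g \<circ> chart_inv c))"

text \<open>The differential of a real function, as a functional on the tangent space; it does not
  depend on the chart chosen.\<close>

definition differential ::
    "('m, 'x::real_normed_vector) chart set \<Rightarrow> ('m \<Rightarrow> real) \<Rightarrow> 'm \<Rightarrow> ('m, 'x) tvec \<Rightarrow> real" where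
  "differential A g x =
     (\<lambda>u\<in>tangent_space A x.
        let c = (SOME c. c \<in> A \<and> x \<in> fst c)
        in frechet_derivative (g \<circ> chart_inv c) (at (snd c x)) (u c))"

definition subdifferential ::
    "('m::topological_space, 'x::real_normed_vector) chart set \<Rightarrow> ('m \<Rightarrow> real) \<Rightarrow> 'm
      \<Rightarrow> (('m, 'x) tvec \<Rightarrow> real) set" where
  "subdifferential A f x =
     {differential A g x | g. C1_function A g \<and> (\<forall>\<^sub>F y in nhds x. f x - g x \<le> f y - g y)}"

definition dual_norm ::
    "('m, 'x::real_normed_vector) chart set \<Rightarrow> ('m \<Rightarrow> ('m, 'x) tvec \<Rightarrow> real) \<Rightarrow> 'm
      \<Rightarrow> (('m, 'x) tvec \<Rightarrow> real) \<Rightarrow> real" where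
  "dual_norm A N x \<xi> = Sup {\<bar>\<xi> u\<bar> | u. u \<in> tangent_space A x \<and> N x u = 1}"

end

theory Submission
  imports Defs
begin

text \<open>
  In a chart at \<open>x\<^sub>0\<close> the norms \<open>\<parallel>\<cdot>\<parallel>\<^sub>x\<close> are, up to a factor \<open>1 + \<epsilon>\<close>, the fixed norm
  \<open>\<parallel>\<cdot>\<parallel>\<close> at \<open>x\<^sub>0\<close>, so it suffices that a lower semicontinuous \<open>F\<close> on a ball of the model space, all of
  whose subgradients \<open>\<xi>\<close> satisfy \<open>\<bar>\<xi> v\<bar> \<le> q \<parallel>v\<parallel>\<close>, is \<open>q\<close>-Lipschitz for that norm. Suppose
  \<open>F y > F x + p\<close> with \<open>v = x - y\<close>, \<open>p > q \<parallel>v\<parallel>\<close>. The norm need not be smooth, but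
  only one direction matters: minimise \<open>F z + p t + c / (T - t) + M (1 - \<beta> ((z - y - t v) / \<rho>))\<close> over
  \<open>z\<close> and \<open>0 \<le> t < T\<close> for some \<open>T > 1\<close>, where the smooth bump \<open>\<beta>\<close> ties \<open>z\<close> to the line. Up to a small \<open>C\<^sup>1\<close>
  perturbation (the variational principle of Deville, Godefroy and Zizler) a minimum exists, and it is
  interior. Criticality in \<open>t\<close> and the subgradient \<open>\<xi>\<close> in \<open>z\<close> combine to \<open>\<xi> v \<le> - p\<close> up to a small error,
  a contradiction. Along a \<open>C\<^sup>1\<close> path \<open>\<gamma>\<close> the local estimate bounds the difference quotients of
  \<open>f \<circ> \<gamma>\<close> at \<open>t\<close> by \<open>K \<parallel>\<gamma>' t\<parallel>\<close>, and integration gives \<open>\<bar>f (\<gamma> b) - f (\<gamma> a)\<bar> \<le> K \<ell>(\<gamma>)\<close>.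
\<close>

section \<open>A smooth variational principle\<close>

lemma lipschitz_has_derivative_bound:
  fixes f :: "'a::real_normed_vector \<Rightarrow> real"
  assumes lip: "L-lipschitz_on UNIV f" and der: "(f has_derivative f') (at x)"
  shows "\<bar>f' v\<bar> \<le> L * norm v"
proof -
  have L: "0 \<le> L" using lip by (rule lipschitz_on_nonneg)
  have "((\<lambda>t. f (x + t *\<^sub>R v)) has_derivative (\<lambda>t. f' (t *\<^sub>R v))) (at 0)"
    by (rule has_derivative_compose[of "\<lambda>t. x + t *\<^sub>R v" "\<lambda>t. t *\<^sub>R v" 0 UNIV f f'])
       (auto intro!: derivative_eq_intros der)
  moreover have "f' (t *\<^sub>R v) = f' v * t" for t
    using linear_scale[OF has_derivative_linear[OF der], of t v] by simp
  ultimately have "((\<lambda>t. f (x + t *\<^sub>R v)) has_field_derivative f' v) (at 0)"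
    by (simp add: has_field_derivative_def)
  then have lim: "((\<lambda>h. \<bar>(f (x + h *\<^sub>R v) - f x) / h\<bar>) \<longlongrightarrow> \<bar>f' v\<bar>) (at 0)"
    by (intro tendsto_rabs) (simp add: DERIV_def)
  have "\<bar>(f (x + h *\<^sub>R v) - f x) / h\<bar> \<le> L * norm v" if "h \<noteq> 0" for h
  proof -
    have "\<bar>f (x + h *\<^sub>R v) - f x\<bar> \<le> L * (\<bar>h\<bar> * norm v)"
      using lipschitz_onD[OF lip, of "x + h *\<^sub>R v" x] by (simp add: dist_norm)
    with that show ?thesis by (simp add: abs_divide divide_simps mult_ac)
  qed
  then show ?thesis
    by (intro tendsto_upperbound[OF lim]) (auto simp: eventually_at_filter)
qed

text \<open>Normal form of a bump: values in [0,1], maximum 1 at the origin, zero off the open unit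
  ball. Rescaling then gives a bump of any centre, radius and height, with explicit control of the
  derivative.\<close>

locale C1_unit_bump =
  fixes \<beta> :: "'x::banach \<Rightarrow> real" and \<beta>' :: "'x \<Rightarrow> 'x \<Rightarrow>\<^sub>L real" and L :: real
  assumes deriv: "(\<beta> has_derivative blinfun_apply (\<beta>' z)) (at z)"
    and deriv_continuous: "continuous_on UNIV \<beta>'"
    and deriv_bound: "norm (\<beta>' z) \<le> L"
    and nonneg: "0 \<le> \<beta> z"
    and le_one: "\<beta> z \<le> 1"
    and at_zero: "\<beta> 0 = 1"
    and outside: "1 \<le> norm z \<Longrightarrow> \<beta> z = 0"

text \<open>An affine change of variable moves a point with \<open>b z0 \<noteq> 0\<close> to the
  origin and the support into the unit ball; dividing by \<open>b z0\<close> gives value 1 there.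
  Composing with sin^2 (pi t / 2) then forces all values into [0,1] while fixing 0 and 1.\<close>

lemma C1_unit_bump_exists:
  fixes b :: "'x::banach \<Rightarrow> real"
  assumes "C1_Lipschitz_bump b"
  shows "\<exists>\<beta> \<beta>' L. C1_unit_bump (\<beta> :: 'x \<Rightarrow> real) \<beta>' L"
proof -
  obtain b' :: "'x \<Rightarrow> 'x \<Rightarrow>\<^sub>L real" where b': "\<And>z. (b has_derivative blinfun_apply (b' z)) (at z)"
    "continuous_on UNIV b'"
    using assms unfolding C1_Lipschitz_bump_def C1_on_def by auto
  obtain L where L: "L-lipschitz_on UNIV b"
    using assms unfolding C1_Lipschitz_bump_def by auto
  have L0: "0 \<le> L" using L by (rule lipschitz_on_nonneg)
  obtain z0 where z0: "b z0 \<noteq> 0"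
    using assms unfolding C1_Lipschitz_bump_def by auto
  have "bounded {z. b z \<noteq> 0}"
    using assms unfolding C1_Lipschitz_bump_def
    by (meson bounded_subset closure_subset)
  then obtain R0 where R0: "\<And>z. b z \<noteq> 0 \<Longrightarrow> norm (z - z0) \<le> R0"
    unfolding bounded_any_center[where a=z0] by (auto simp: dist_norm norm_minus_commute)
  \<comment> \<open>Adding 1 makes the bound strict, so that the rescaled bump vanishes already on
    the unit sphere.\<close>
  define R where "R = \<bar>R0\<bar> + 1"
  have R: "0 < R" "\<And>z. b z \<noteq> 0 \<Longrightarrow> norm (z - z0) < R"
    using R0 by (fastforce simp: R_def)+
  define \<tau> where "\<tau> z = b (z0 + R *\<^sub>R z) / b z0" for z
  define \<beta> where "\<beta> z = (sin (pi / 2 * \<tau> z))\<^sup>2" for z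
  \<comment> \<open>The double angle formula merges the product of sine and cosine into one sine, of
    absolute value at most 1.\<close>
  define \<beta>' where "\<beta>' z = (pi / 2 * sin (pi * \<tau> z) * R / b z0) *\<^sub>R b' (z0 + R *\<^sub>R z)" for z
  have \<tau>_deriv: "(\<tau> has_derivative (\<lambda>h. b' (z0 + R *\<^sub>R z) (R *\<^sub>R h) / b z0)) (at z)" for z
    unfolding \<tau>_def
    by (intro bounded_linear.has_derivative[OF bounded_linear_divide]
        has_derivative_compose[of "\<lambda>t. z0 + R *\<^sub>R t" "\<lambda>t. R *\<^sub>R t" z UNIV b, OF _ b'(1)])
       (auto intro!: derivative_eq_intros)
  have "C1_unit_bump \<beta> \<beta>' (pi / 2 * R / \<bar>b z0\<bar> * L)"
  proof
    fix z
    have dbl: "sin (pi * \<tau> z) = 2 * sin (pi / 2 * \<tau> z) * cos (pi / 2 * \<tau> z)"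
      using sin_double[of "pi / 2 * \<tau> z"] by (simp add: mult_ac)
    show "(\<beta> has_derivative blinfun_apply (\<beta>' z)) (at z)"
      unfolding \<beta>_def
      by (rule derivative_eq_intros \<tau>_deriv refl)+
         (auto simp: fun_eq_iff \<beta>'_def blinfun.bilinear_simps dbl field_simps)
    have "norm (b' w) \<le> L" for w
      using lipschitz_has_derivative_bound[OF L b'(1)] L0
      by (intro norm_blinfun_bound) auto
    moreover have "\<bar>pi / 2 * sin (pi * \<tau> z) * R / b z0\<bar> \<le> pi / 2 * R / \<bar>b z0\<bar>"
      using R(1) by (auto simp: abs_mult abs_divide intro!: divide_right_mono)
    ultimately show "norm (\<beta>' z) \<le> pi / 2 * R / \<bar>b z0\<bar> * L"
      unfolding \<beta>'_def norm_scaleR using R(1) L0 by (intro mult_mono) auto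
    show "0 \<le> \<beta> z" "\<beta> z \<le> 1" "\<beta> 0 = 1"
      using z0 abs_sin_le_one[of "pi / 2 * \<tau> z"] by (auto simp: \<beta>_def \<tau>_def abs_square_le_1)
    show "\<beta> z = 0" if "1 \<le> norm z"
    proof -
      have "b (z0 + R *\<^sub>R z) = 0"
        using R(2)[of "z0 + R *\<^sub>R z"] that R(1) by auto
      then show ?thesis by (simp add: \<beta>_def \<tau>_def)
    qed
  next
    have "continuous_on UNIV \<tau>"
      using \<tau>_deriv by (meson continuous_at_imp_continuous_on has_derivative_continuous)
    moreover have "continuous_on UNIV (\<lambda>z. b' (z0 + R *\<^sub>R z))"
      by (rule continuous_on_compose2[OF b'(2)]) (auto intro!: continuous_intros)
    ultimately show "continuous_on UNIV \<beta>'"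
      unfolding \<beta>'_def by (auto intro!: continuous_intros simp: z0)
  qed
  then show ?thesis by blast
qed

context C1_unit_bump
begin

lemma L_nonneg: "0 \<le> L"
  using deriv_bound[of 0] norm_ge_zero order_trans by blast

lemma scaled_has_derivative:
  "((\<lambda>z. \<beta> (a *\<^sub>R (z - c))) has_derivative blinfun_apply (a *\<^sub>R \<beta>' (a *\<^sub>R (z - c)))) (at z)"
proof -
  have "((\<lambda>z. \<beta> (a *\<^sub>R (z - c))) has_derivative (\<lambda>h. \<beta>' (a *\<^sub>R (z - c)) (a *\<^sub>R h))) (at z)"
    by (rule has_derivative_compose[of "\<lambda>z. a *\<^sub>R (z - c)" "\<lambda>h. a *\<^sub>R h" z UNIV \<beta>])
       (auto intro!: derivative_eq_intros deriv)
  then show ?thesis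
    by (simp add: blinfun.scaleR_right scaleR_blinfun.rep_eq)
qed

lemma scaled_deriv_continuous: "continuous_on UNIV (\<lambda>z. a *\<^sub>R \<beta>' (a *\<^sub>R (z - c)))"
  by (intro continuous_intros continuous_on_compose2[OF deriv_continuous]) auto

lemma continuous_on_bump: "continuous_on S \<beta>"
  using deriv by (meson continuous_at_imp_continuous_on has_derivative_continuous)

lemma lipschitz: "\<bar>\<beta> y - \<beta> z\<bar> \<le> L * norm (y - z)"
  using differentiable_bound[of UNIV \<beta> "\<lambda>z. blinfun_apply (\<beta>' z)" L y z] deriv deriv_bound
  by (simp add: norm_blinfun.rep_eq[symmetric])

text \<open>The origin is a maximum. Hence cutting off by the bump does not change the derivative at
  the centre when the other factor is differentiable there.\<close>

lemma deriv_at_zero: "\<beta>' 0 = 0"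
proof -
  have "blinfun_apply (\<beta>' 0) = (\<lambda>v. 0)"
    by (rule differential_zero_maxmin[of 0 UNIV \<beta>]) (auto simp: deriv at_zero le_one)
  then show ?thesis by (intro blinfun_eqI) simp
qed

text \<open>Height e / 4^k and radius 2^-k give a k-th derivative of norm at most e L / 2^k, so the
  values and the derivatives are both dominated by geometric series, whatever the centres
  \<open>z k\<close> are.\<close>

lemma bump_series:
  fixes e :: real and z :: "nat \<Rightarrow> 'x"
  assumes e: "0 < e"
  defines "g \<equiv> \<lambda>w. \<Sum>k. e / 4 ^ k * \<beta> (2 ^ k *\<^sub>R (w - z k))"
  shows "\<And>w. (\<lambda>k. e / 4 ^ k * \<beta> (2 ^ k *\<^sub>R (w - z k))) sums g w"
    and "\<And>w. 0 \<le> g w" and "\<And>w. g w \<le> 2 * e"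
    and "\<exists>g'. (\<forall>w. (g has_derivative blinfun_apply (g' w)) (at w)) \<and> continuous_on UNIV g' \<and>
          (\<forall>w. norm (g' w) \<le> 2 * e * L)"
proof -
  define t where "t k w = e / 4 ^ k * \<beta> (2 ^ k *\<^sub>R (w - z k))" for k w
  define t' where "t' k w = (e / 4 ^ k) *\<^sub>R (2 ^ k *\<^sub>R \<beta>' (2 ^ k *\<^sub>R (w - z k)))" for k w
  have geo: "summable (\<lambda>k. C / c ^ k)" if "1 < c" for C c :: real
    using summable_mult[OF summable_geometric[of "1/c"], of C] that
    by (simp add: power_divide)
  have t0: "0 \<le> t k w" "t k w \<le> e / 4 ^ k" for k w
    using e nonneg le_one by (auto simp: t_def divide_simps)
  have t_summable: "summable (\<lambda>k. t k w)" for w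
    by (rule summable_comparison_test'[OF geo[of 4 e], of 0]) (use t0 in auto)
  show sums: "(\<lambda>k. e / 4 ^ k * \<beta> (2 ^ k *\<^sub>R (w - z k))) sums g w" for w
    using summable_sums[OF t_summable] unfolding t_def g_def .
  show "0 \<le> g w" for w
    using suminf_nonneg[OF t_summable] t0 unfolding t_def g_def by blast
  have geo_sum: "(\<Sum>k. C / c ^ k) = C * (c / (c - 1))" if "1 < c" for C c :: real
    using suminf_mult[OF summable_geometric[of "1/c"], of C] suminf_geometric[of "1/c"] that
    by (simp add: power_divide divide_simps)
  have "g w \<le> (\<Sum>k. e / 4 ^ k)" for w
    unfolding g_def using t0(2) t_summable geo[of 4 e] unfolding t_def by (intro suminf_le) auto
  then show "g w \<le> 2 * e" for w
    using e geo_sum[of 4 e] order_trans[of "g w" "e * (4 / 3)" "2 * e"] by simp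
  have t'_bound: "norm (t' k w) \<le> e * L / 2 ^ k" for k w
  proof -
    have "norm (t' k w) = e / 2 ^ k * norm (\<beta>' (2 ^ k *\<^sub>R (w - z k)))"
      using e power_mult_distrib[of "2::real" 2 k] by (simp add: t'_def)
    also have "\<dots> \<le> e / 2 ^ k * L"
      using e deriv_bound by (intro mult_left_mono) auto
    finally show ?thesis by simp
  qed
  have t'_summable: "summable (\<lambda>k. norm (t' k w))" for w
    by (rule summable_comparison_test'[OF geo[of 2 "e * L"], of 0]) (use t'_bound in auto)
  define g' where "g' w = (\<Sum>k. t' k w)" for w
  have unif: "uniform_limit UNIV (\<lambda>n w. \<Sum>k<n. t' k w) g' sequentially"
    unfolding g'_def by (rule Weierstrass_m_test[OF t'_bound geo]) auto
  have "continuous_on UNIV (t' k)" for k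
    unfolding t'_def by (intro continuous_on_scaleR continuous_on_const scaled_deriv_continuous)
  then have g'_cont: "continuous_on UNIV g'"
    by (intro uniform_limit_theorem[OF _ unif]) (auto intro!: continuous_intros always_eventually)
  have "norm (g' w) \<le> 2 * e * L" for w
  proof -
    have "norm (g' w) \<le> (\<Sum>k. norm (t' k w))"
      unfolding g'_def by (rule summable_norm[OF t'_summable])
    also have "\<dots> \<le> (\<Sum>k. e * L / 2 ^ k)"
      by (intro suminf_le t'_bound t'_summable geo) simp
    finally show ?thesis using geo_sum[of 2 "e * L"] by simp
  qed
  moreover have "(g has_derivative blinfun_apply (g' w)) (at w)" for w
  proof -
    have "\<exists>G. \<forall>x\<in>UNIV. (\<lambda>n. t n x) sums G x \<and>
        (G has_derivative blinfun_apply (g' x)) (at x within UNIV)"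
    proof (rule has_derivative_series[where f'="\<lambda>k x. blinfun_apply (t' k x)"])
      show "(t n has_derivative blinfun_apply (t' n x)) (at x within UNIV)" for n x
        using has_derivative_mult_right[OF scaled_has_derivative[of "2^n" "z n" x], of "e / 4 ^ n"]
        by (simp add: t_def[abs_def] t'_def scaleR_blinfun.rep_eq mult_ac)
      fix \<epsilon> :: real assume "0 < \<epsilon>"
      with unif have "\<forall>\<^sub>F n in sequentially. \<forall>x\<in>UNIV. dist (\<Sum>k<n. t' k x) (g' x) < \<epsilon>"
        by (rule uniform_limitD)
      then show "\<forall>\<^sub>F n in sequentially. \<forall>x\<in>UNIV. \<forall>h.
          norm ((\<Sum>i<n. blinfun_apply (t' i x) h) - blinfun_apply (g' x) h) \<le> \<epsilon> * norm h"
      proof (eventually_elim, intro ballI allI)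
        fix n x h assume *: "\<forall>x\<in>UNIV. dist (\<Sum>k<n. t' k x) (g' x) < \<epsilon>"
        have "(\<Sum>i<n. t' i x h) - g' x h = ((\<Sum>i<n. t' i x) - g' x) h"
          by (simp add: blinfun.bilinear_simps)
        then have "norm ((\<Sum>i<n. t' i x h) - g' x h) \<le> norm ((\<Sum>i<n. t' i x) - g' x) * norm h"
          using norm_blinfun by metis
        also have "\<dots> \<le> \<epsilon> * norm h"
          using * by (intro mult_right_mono) (auto simp: dist_norm less_imp_le)
        finally show "norm ((\<Sum>i<n. t' i x h) - g' x h) \<le> \<epsilon> * norm h" .
      qed
    qed (use summable_sums[OF t_summable] in auto)
    then obtain G where G: "\<And>x. (\<lambda>n. t n x) sums G x" "(G has_derivative blinfun_apply (g' w)) (at w)"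
      by auto
    \<comment> \<open>Termwise differentiation only provides some sum G with the right derivative;
      uniqueness of limits identifies it with g.\<close>
    have "G = g"
      using sums_unique2[OF G(1)] sums unfolding t_def by blast
    with G(2) show ?thesis by simp
  qed
  ultimately show "\<exists>g'. (\<forall>w. (g has_derivative blinfun_apply (g' w)) (at w)) \<and>
      continuous_on UNIV g' \<and> (\<forall>w. norm (g' w) \<le> 2 * e * L)"
    using g'_cont by blast
qed

end

section \<open>Lower semicontinuity and the variational principle\<close>

definition lsc_on :: "'a::topological_space set \<Rightarrow> ('a \<Rightarrow> real) \<Rightarrow> bool" where
  "lsc_on S f \<longleftrightarrow> (\<forall>x\<in>S. \<forall>a < f x. \<forall>\<^sub>F y in at x within S. a < f y)"

lemma lsc_on_add_continuous:
  assumes f: "lsc_on S f" and g: "continuous_on S g"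
  shows "lsc_on S (\<lambda>x. f x + g x)"
  unfolding lsc_on_def
proof (intro ballI allI impI)
  fix x a assume x: "x \<in> S" and a: "a < f x + g x"
  define d where "d = (f x + g x - a) / 2"
  have d: "0 < d" using a by (simp add: d_def)
  have "\<forall>\<^sub>F y in at x within S. f x - d < f y"
    using f x d by (simp add: lsc_on_def)
  moreover have "\<forall>\<^sub>F y in at x within S. g x - d < g y"
    using g x d by (intro order_tendstoD(1)[of g "g x"]) (auto simp: continuous_on_def)
  ultimately show "\<forall>\<^sub>F y in at x within S. a < f y + g y"
    by eventually_elim (auto simp: d_def field_simps)
qed

lemma lsc_on_sequentially:
  assumes "lsc_on S f" "x \<in> S" "a < f x" "z \<longlonglongrightarrow> x" "\<And>n. z n \<in> S"
  shows "\<forall>\<^sub>F n in sequentially. a < f (z n)"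
proof -
  have "\<forall>\<^sub>F y in at x within S. a < f y"
    using assms(1-3) by (simp add: lsc_on_def)
  \<comment> \<open>The punctured filter omits x, which the sequence may visit; there the bound is
    the hypothesis itself.\<close>
  then have "\<forall>\<^sub>F y in nhds x. y \<in> S \<longrightarrow> a < f y"
    unfolding eventually_at_filter by eventually_elim (use assms(3) in auto)
  then have "\<forall>\<^sub>F n in sequentially. z n \<in> S \<longrightarrow> a < f (z n)"
    using assms(4) by (rule eventually_compose_filterlim)
  then show ?thesis using assms(5) by simp
qed

lemma near_minimizer_exists:
  fixes F :: "'a \<Rightarrow> real"
  assumes "D \<noteq> {}" "bdd_below (F ` D)" "0 < e"
  shows "\<exists>z\<in>D. \<forall>w\<in>D. F z < F w + e"
proof -
  obtain z where z: "z \<in> D" "F z < Inf (F ` D) + e"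
    using cInf_lessD[of "F ` D" "Inf (F ` D) + e"] assms by auto
  then show ?thesis
    using cInf_lower[OF _ assms(2)] by (intro bexI[of _ z]) fastforce+
qed

context C1_unit_bump
begin

text \<open>The bump of height \<open>\<epsilon>\<^sub>n = e / 4 ^ n\<close> and radius \<open>2 ^ - n\<close> is subtracted at a point \<open>z\<^sub>n\<close> that is minimal
  up to \<open>\<epsilon>\<^sub>n / 2\<close> for the function reached so far. As the later heights add up to less than \<open>\<epsilon>\<^sub>n / 2\<close>,
  all later near minimisers lie in the ball of radius \<open>2 ^ - n\<close> around \<open>z\<^sub>n\<close>.\<close>

theorem smooth_variational_principle:
  fixes F :: "'x \<Rightarrow> real"
  assumes D: "closed D" "D \<noteq> {}" and lsc: "lsc_on D F" and bdd: "bdd_below (F ` D)"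
    and \<epsilon>: "0 < \<epsilon>"
  shows "\<exists>g g' z. z \<in> D \<and> (\<forall>w\<in>D. F z - g z \<le> F w - g w) \<and>
    (\<forall>w. 0 \<le> g w \<and> g w \<le> \<epsilon>) \<and>
    (\<forall>w. (g has_derivative blinfun_apply (g' w)) (at w)) \<and> continuous_on UNIV g' \<and>
    (\<forall>w. norm (g' w) \<le> \<epsilon>)"
proof -
  \<comment> \<open>Both totals of \<open>bump_series\<close>, 2e for the values and 2eL for the
    derivatives, have to stay below \<epsilon>.\<close>
  define e where "e = \<epsilon> / (2 * (L + 1))"
  have e: "0 < e" "2 * e \<le> \<epsilon>" "2 * e * L \<le> \<epsilon>"
    using \<epsilon> L_nonneg by (auto simp: e_def divide_simps)
  define pick where "pick n G = (SOME z. z \<in> D \<and> (\<forall>w\<in>D. G z < G w + e / 4 ^ n / 2))"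
    for n and G :: "'x \<Rightarrow> real"
  \<comment> \<open>Each centre depends on the function reached so far, so functions and centres
    come from one recursion.\<close>
  define G where "G = rec_nat F (\<lambda>n G w. G w - e / 4 ^ n * \<beta> (2 ^ n *\<^sub>R (w - pick n G)))"
  define z where "z n = pick n (G n)" for n
  define t where "t k w = e / 4 ^ k * \<beta> (2 ^ k *\<^sub>R (w - z k))" for k w
  have t: "0 \<le> t k w" "t k w \<le> e / 4 ^ k" for k w
    using e nonneg le_one by (auto simp: t_def divide_simps)
  have G_sum: "G n w = F w - (\<Sum>k<n. t k w)" for n w
    by (induction n) (simp_all add: G_def t_def z_def)
  define g where "g w = (\<Sum>k. t k w)" for w
  note series = bump_series[OF e(1), where z=z, folded t_def, folded g_def]
  have sum_le_g: "(\<Sum>k<n. t k w) \<le> g w" for n w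
    using sum_le_suminf[of "\<lambda>k. t k w" "{..<n}"] series(1)[of w] t
    by (auto simp: sums_iff)
  obtain m where m: "\<And>w. w \<in> D \<Longrightarrow> m \<le> F w"
    using bdd by (auto simp: bdd_below_def)
  have "m - \<epsilon> \<le> G n w" if "w \<in> D" for n w
    using m[OF that] sum_le_g[of w n] series(3)[of w] e(2) by (simp add: G_sum)
  then have "bdd_below (G n ` D)" for n
    by (rule bdd_belowI2)
  then have "\<exists>w. w \<in> D \<and> (\<forall>v\<in>D. G n w < G n v + e / 4 ^ n / 2)" for n
    using near_minimizer_exists[OF D(2), of "G n" "e / 4 ^ n / 2"] e(1) by auto
  then have "z n \<in> D \<and> (\<forall>w\<in>D. G n (z n) < G n w + e / 4 ^ n / 2)" for n
    unfolding z_def pick_def by (rule someI_ex)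
  then have z: "z n \<in> D" "w \<in> D \<Longrightarrow> G n (z n) < G n w + e / 4 ^ n / 2" for n w
    by auto
  \<comment> \<open>The extra summand is the geometric tail from m on. Keeping it makes the
    induction close, and it absorbs the tolerance in the choice of z m.\<close>
  have eps_sum: "(\<Sum>k=Suc n..<m. e / 4 ^ k) + 4 / 3 * (e / 4 ^ m) \<le> e / 4 ^ n / 3"
    if "Suc n \<le> m" for n m
    using that by (induction m rule: dec_induct) simp_all
  have close: "norm (z m - z n) < 1 / 2 ^ n" if nm: "n < m" for n m
  proof (rule ccontr)
    assume "\<not> norm (z m - z n) < 1 / 2 ^ n"
    \<comment> \<open>Off its ball, bump n contributes nothing at z m but its full height at z n.
      The tolerances of z n and z m, half a height each, and the bumps strictly between n and m,
      with total below a third of height n, cannot make up for this.\<close>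
    then have "t n (z m) = 0"
      using outside[of "2 ^ n *\<^sub>R (z m - z n)"] by (simp add: t_def divide_simps mult.commute)
    moreover have split: "G m w = G n w - t n w - (\<Sum>k=Suc n..<m. t k w)" for w
      unfolding G_sum using Suc_leI[OF nm] by (induction m rule: dec_induct) simp_all
    moreover have "(\<Sum>k=Suc n..<m. t k (z m)) \<le> (\<Sum>k=Suc n..<m. e / 4 ^ k)"
      by (intro sum_mono t)
    moreover have "t n (z n) = e / 4 ^ n"
      by (simp add: t_def at_zero)
    moreover have "0 \<le> (\<Sum>k=Suc n..<m. t k (z n))"
      by (intro sum_nonneg t)
    moreover have "0 < e / 4 ^ m" "0 < e / 4 ^ n" using e by auto
    moreover define e1 e2 where "e1 = e / 4 ^ n" and "e2 = e / 4 ^ m"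
    ultimately show False
      using z(2)[OF z(1)[of n], of m] z(2)[OF z(1)[of m], of n] eps_sum[OF Suc_leI[OF nm]]
        split[of "z m"] split[of "z n"]
      unfolding e1_def[symmetric] e2_def[symmetric] by linarith
  qed
  have "Cauchy z"
  proof (rule metric_CauchyI)
    fix r :: real assume "0 < r"
    then obtain n where n: "(1 / 2) ^ n < r / 2"
      using real_arch_pow_inv[of "r / 2" "1 / 2"] by auto
    have "dist (z m) (z (Suc n)) < r / 2" if "Suc n \<le> m" for m
    proof (cases "m = Suc n")
      case False
      then have "norm (z m - z (Suc n)) < 1 / 2 ^ Suc n" using that by (intro close) auto
      also have "\<dots> \<le> (1 / 2) ^ n" by (simp add: power_divide divide_simps)
      finally show ?thesis using n by (simp add: dist_norm)
    qed (use \<open>0 < r\<close> in simp)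
    then show "\<exists>M. \<forall>m\<ge>M. \<forall>n\<ge>M. dist (z m) (z n) < r"
      using dist_triangle_half_l by blast
  qed
  then obtain z\<^sub>0 where z\<^sub>0: "z \<longlonglongrightarrow> z\<^sub>0"
    using Cauchy_convergent_iff convergent_def by blast
  then have z\<^sub>0D: "z\<^sub>0 \<in> D"
    using closed_sequentially[OF D(1) _ z\<^sub>0] z(1) by blast
  obtain g' where g': "\<And>w. (g has_derivative blinfun_apply (g' w)) (at w)"
    "continuous_on UNIV g'" "\<And>w. norm (g' w) \<le> 2 * e * L"
    using series(4) by blast
  have "continuous_on D (\<lambda>w. - g w)"
    using g'(1) by (intro continuous_intros continuous_at_imp_continuous_on ballI)
      (rule has_derivative_continuous)
  from lsc_on_add_continuous[OF lsc this] have lsc_g: "lsc_on D (\<lambda>w. F w - g w)"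
    by simp
  have "F z\<^sub>0 - g z\<^sub>0 \<le> F w - g w" if w: "w \<in> D" for w
  proof (rule ccontr)
    assume "\<not> F z\<^sub>0 - g z\<^sub>0 \<le> F w - g w"
    \<comment> \<open>The level a separates the two values: near minimality pushes G n (z n)
      eventually below a, while lower semicontinuity keeps F - g, and hence the larger G n, above a
      along the sequence.\<close>
    then obtain a where a: "F w - g w < a" "a < F z\<^sub>0 - g z\<^sub>0"
      using dense[of "F w - g w" "F z\<^sub>0 - g z\<^sub>0"] by auto
    have "(\<lambda>n. e / 4 ^ n / 2) \<longlonglongrightarrow> 0"
      using tendsto_mult_right_zero[OF LIMSEQ_power_zero[of "1/4 :: real"], of "e / 2"]
      by (simp add: power_divide mult.commute)
    then have "(\<lambda>n. G n w + e / 4 ^ n / 2) \<longlonglongrightarrow> (F w - g w) + 0"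
      unfolding G_sum using series(1)[of w] by (intro tendsto_intros) (auto simp: sums_def)
    then have "\<forall>\<^sub>F n in sequentially. G n w + e / 4 ^ n / 2 < a"
      using a by (intro order_tendstoD(2)) auto
    moreover have "\<forall>\<^sub>F n in sequentially. a < F (z n) - g (z n)"
      by (rule lsc_on_sequentially[OF lsc_g z\<^sub>0D a(2) z\<^sub>0 z(1)])
    ultimately have "\<forall>\<^sub>F n in sequentially. False"
    proof eventually_elim
      case (elim n)
      then show ?case
        using z(2)[OF w, of n] sum_le_g[of "z n" n] G_sum[of n "z n"] by linarith
    qed
    then show False by simp
  qed
  moreover have "0 \<le> g w" "g w \<le> \<epsilon>" "norm (g' w) \<le> \<epsilon>" for w
    using series(2,3)[of w] g'(3)[of w] e by auto
  ultimately show ?thesis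
    using z\<^sub>0D g' by blast
qed

end

section \<open>Subgradients of prescribed slope\<close>

lemma continuous_on_if_lipschitz_bound:
  fixes f :: "'a::real_normed_vector \<Rightarrow> real"
  assumes "\<And>y z. f y \<le> f z + C * norm (y - z)" "0 \<le> C"
  shows "continuous_on S f"
proof (rule lipschitz_on_continuous_on[of C])
  show "C-lipschitz_on S f"
    using assms(1)[of x y for x y] assms
    by (intro lipschitz_onI) (smt (verit) dist_norm norm_minus_commute real_norm_def)+
qed

context C1_unit_bump
begin

text \<open>The barrier \<open>c / (T - t)\<close> keeps \<open>t\<close> away from \<open>T\<close> and is nondecreasing, so it only makes the slope
  steeper; \<open>t = 0\<close> is excluded by lower semicontinuity at \<open>y\<close>. The parameter \<open>t\<close> is eliminated by
  compactness before the variational principle is applied, so that only \<open>z\<close> is perturbed.\<close>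

theorem steep_subgradient_exists:
  fixes F :: "'x \<Rightarrow> real"
  assumes x: "x \<in> ball u R" and y: "y \<in> ball u R"
    and lsc: "lsc_on (cball u R) F" and m: "\<And>z. z \<in> cball u R \<Longrightarrow> m \<le> F z"
    and p: "0 \<le> p" "F x + p < F y" and \<delta>: "0 < \<delta>"
  shows "\<exists>h h' z. z \<in> ball u R \<and> (\<forall>w. (h has_derivative blinfun_apply (h' w)) (at w)) \<and>
    continuous_on UNIV h' \<and> (\<forall>w\<in>cball u R. F z - h z \<le> F w - h w) \<and>
    blinfun_apply (h' z) (x - y) \<le> - p + \<delta>"
proof -
  define v where "v = x - y"
  \<comment> \<open>The line reaches x at parameter 1; running a little further leaves room for the
    barrier beyond it.\<close>
  obtain s where s: "0 < s" "x + s *\<^sub>R v \<in> ball u R"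
  proof -
    have "isCont (\<lambda>s. x + s *\<^sub>R v) 0" by (intro continuous_intros)
    then have "((\<lambda>s. x + s *\<^sub>R v) \<longlongrightarrow> x) (at_right 0)"
      by (simp add: isCont_def filterlim_at_split)
    then have "\<forall>\<^sub>F s in at_right 0. x + s *\<^sub>R v \<in> ball u R"
      using x by (rule topological_tendstoD[OF _ open_ball])
    then have "\<forall>\<^sub>F s in at_right 0. 0 < s \<and> x + s *\<^sub>R v \<in> ball u R"
      by (intro eventually_conj eventually_at_right_less)
    then show ?thesis using that eventually_happens'[OF trivial_limit_at_right_real] by blast
  qed
  define T where "T = 1 + s"
  have T: "1 < T" "y + T *\<^sub>R v \<in> ball u R"
    using s by (auto simp: T_def v_def algebra_simps)
  define \<rho>\<^sub>0 where "\<rho>\<^sub>0 = R - max (dist u y) (dist u (y + T *\<^sub>R v))"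
  have \<rho>\<^sub>0: "0 < \<rho>\<^sub>0" using y T(2) by (simp add: \<rho>\<^sub>0_def)
  have near_ball: "z \<in> ball u R"
    if t: "0 \<le> t" "t \<le> T" and z: "norm (z - (y + t *\<^sub>R v)) < \<rho>\<^sub>0" for t z
  proof -
    have "y + t *\<^sub>R v = (1 - t / T) *\<^sub>R y + (t / T) *\<^sub>R (y + T *\<^sub>R v)"
      using T(1) by (simp add: algebra_simps)
    also have "\<dots> \<in> cball u (R - \<rho>\<^sub>0)"
      using convexD_alt[OF convex_cball, of y u "R - \<rho>\<^sub>0" "y + T *\<^sub>R v" "t / T"] t T(1)
      by (simp add: \<rho>\<^sub>0_def)
    finally have "dist u (y + t *\<^sub>R v) \<le> R - \<rho>\<^sub>0" by simp
    with z dist_triangle[of u z "y + t *\<^sub>R v"] show ?thesis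
      by (simp add: dist_norm norm_minus_commute)
  qed
  \<comment> \<open>The surplus is split into four: one part for the barrier at parameter 1, one for
    the perturbation, and two remain as a gap below F y.\<close>
  define \<eta> where "\<eta> = (F y - F x - p) / 4"
  have \<eta>: "0 < \<eta>" "F x + p = F y - 4 * \<eta>" using p(2) by (auto simp: \<eta>_def field_simps)
  have "\<forall>\<^sub>F z in at y within cball u R. F y - \<eta> < F z"
    using lsc y \<eta>(1) by (simp add: lsc_on_def)
  then obtain \<rho>\<^sub>1 where \<rho>\<^sub>1: "0 < \<rho>\<^sub>1" "\<And>z. z \<in> cball u R \<Longrightarrow> norm (z - y) < \<rho>\<^sub>1 \<Longrightarrow> F y - \<eta> < F z"
    unfolding eventually_at dist_norm using \<eta>(1) by force
  define \<rho> where "\<rho> = min \<rho>\<^sub>0 \<rho>\<^sub>1"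
  have \<rho>: "0 < \<rho>" "\<rho> \<le> \<rho>\<^sub>0" "\<rho> \<le> \<rho>\<^sub>1" using \<rho>\<^sub>0 \<rho>\<^sub>1 by (auto simp: \<rho>_def)
  \<comment> \<open>The barrier then costs exactly \<eta> at t = 1.\<close>
  define c where "c = \<eta> * (T - 1)"
  have c: "0 < c" using \<eta> T by (simp add: c_def)
  \<comment> \<open>M exceeds the largest possible gain F y - m, so paying M once rules out a
    minimum.\<close>
  define M where "M = \<bar>F y - m\<bar> + 1"
  have M: "0 < M" "F y < m + M" by (auto simp: M_def)
  \<comment> \<open>Close enough to T that the barrier has reached M at T', yet beyond 1; the
    parameter now ranges over a compact interval.\<close>
  define T' where "T' = T - min (c / M) ((T - 1) / 2)"
  have T': "1 < T'" "T' < T"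
    using T(1) c M min.cobounded2[of "c / M" "(T - 1) / 2"] by (auto simp: T'_def)
  have cT': "M \<le> c / (T - T')"
  proof -
    have "T - T' \<le> c / M" by (simp add: T'_def)
    then show ?thesis using T'(2) M(1) by (simp add: field_simps)
  qed
  define \<psi> where "\<psi> t z = p * t + c / (T - t) + M * (1 - \<beta> ((1 / \<rho>) *\<^sub>R (z - (y + t *\<^sub>R v))))" for t z
  have tc_nonneg: "0 \<le> p * t" "0 \<le> c / (T - t)" if "t \<in> {0..T'}" for t
    using that p(1) c T' by auto
  have \<psi>_ge: "p * t + c / (T - t) \<le> \<psi> t z" if "t \<in> {0..T'}" for t z
    using that p(1) c T' M(1) le_one by (auto simp: \<psi>_def)
  have \<psi>_cont: "continuous_on {0..T'} (\<lambda>t. \<psi> t z)" for z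
    unfolding \<psi>_def using T'(2)
    by (intro continuous_intros continuous_on_compose2[OF continuous_on_bump[of UNIV]]) auto
  have "\<exists>t\<in>{0..T'}. \<forall>t'\<in>{0..T'}. \<psi> t z \<le> \<psi> t' z" for z
    using T' by (intro continuous_attains_inf \<psi>_cont) auto
  then obtain \<tau> where \<tau>: "\<And>z. \<tau> z \<in> {0..T'}" "\<And>z t. t \<in> {0..T'} \<Longrightarrow> \<psi> (\<tau> z) z \<le> \<psi> t z"
    by metis
  define \<Phi> where "\<Phi> z = \<psi> (\<tau> z) z" for z
  have "\<Phi> z \<le> \<Phi> w + (M * L / \<rho>) * norm (z - w)" for z w
  proof -
    have "\<bar>\<beta> ((1 / \<rho>) *\<^sub>R (w - a)) - \<beta> ((1 / \<rho>) *\<^sub>R (z - a))\<bar> \<le> L / \<rho> * norm (z - w)" for a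
      using lipschitz[of "(1 / \<rho>) *\<^sub>R (w - a)" "(1 / \<rho>) *\<^sub>R (z - a)"] \<rho>(1)
      by (simp add: scaleR_diff_right[symmetric] norm_minus_commute)
    then have "M * (\<beta> ((1 / \<rho>) *\<^sub>R (w - a)) - \<beta> ((1 / \<rho>) *\<^sub>R (z - a))) \<le> M * (L / \<rho> * norm (z - w))"
      for a using M(1) by (intro mult_left_mono) (auto intro: order_trans[OF abs_ge_self])
    \<comment> \<open>The minimising parameter for w serves as competitor for z, so \<Phi> inherits
      the Lipschitz constant of the bump term.\<close>
    from this[of "y + \<tau> w *\<^sub>R v"]
    have "\<psi> (\<tau> w) z \<le> \<psi> (\<tau> w) w + M * L / \<rho> * norm (z - w)"
      by (simp add: \<psi>_def algebra_simps)
    with \<tau>(2)[OF \<tau>(1)[of w], of z] show ?thesis by (simp add: \<Phi>_def)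
  qed
  then have "continuous_on (cball u R) \<Phi>"
    using M(1) \<rho>(1) L_nonneg by (intro continuous_on_if_lipschitz_bound[where C="M * L / \<rho>"]) auto
  with lsc have lsc\<Phi>: "lsc_on (cball u R) (\<lambda>z. F z + \<Phi> z)"
    by (rule lsc_on_add_continuous)
  have \<Phi>_nonneg: "0 \<le> \<Phi> z" for z
    using \<psi>_ge[OF \<tau>(1)[of z], of z] tc_nonneg[OF \<tau>(1)[of z]] by (simp add: \<Phi>_def)
  \<comment> \<open>Small enough that the perturbation changes values by at most \<eta> and the
    slope along v by at most \<delta>.\<close>
  define \<epsilon> where "\<epsilon> = min \<eta> (\<delta> / (norm v + 1))"
  have "0 < norm v + 1" by (simp add: add_nonneg_pos)
  then have \<epsilon>: "0 < \<epsilon>" "\<epsilon> \<le> \<eta>" "\<epsilon> * (norm v + 1) \<le> \<delta>"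
    using \<eta>(1) \<delta> by (auto simp: \<epsilon>_def min_def divide_simps)
  have "bdd_below ((\<lambda>z. F z + \<Phi> z) ` cball u R)"
    using m \<Phi>_nonneg by (intro bdd_belowI2[of _ m]) (simp add: add_increasing2)
  moreover have "cball u R \<noteq> {}" using x ball_subset_cball by blast
  ultimately have "\<exists>g g' z. z \<in> cball u R \<and> (\<forall>w\<in>cball u R. F z + \<Phi> z - g z \<le> F w + \<Phi> w - g w) \<and>
    (\<forall>w. 0 \<le> g w \<and> g w \<le> \<epsilon>) \<and>
    (\<forall>w. (g has_derivative blinfun_apply (g' w)) (at w)) \<and> continuous_on UNIV g' \<and>
    (\<forall>w. norm (g' w) \<le> \<epsilon>)"
    by (intro smooth_variational_principle closed_cball lsc\<Phi> \<epsilon>(1))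
  then
  obtain g g' z where z: "z \<in> cball u R"
    and min: "\<And>w. w \<in> cball u R \<Longrightarrow> F z + \<Phi> z - g z \<le> F w + \<Phi> w - g w"
    and g: "\<And>w. 0 \<le> g w" "\<And>w. g w \<le> \<epsilon>"
    and g': "\<And>w. (g has_derivative blinfun_apply (g' w)) (at w)" "continuous_on UNIV g'"
      "\<And>w. norm (g' w) \<le> \<epsilon>"
    by blast
  define t where "t = \<tau> z"
  have t: "0 \<le> t" "t \<le> T'" "t \<in> {0..T'}" using \<tau>(1)[of z] by (auto simp: t_def)
  have \<Phi>z: "\<Phi> z = \<psi> t z" by (simp add: \<Phi>_def t_def)
  have "\<Phi> x \<le> p + \<eta>"
    using \<tau>(2)[of 1 x] T T' by (simp add: \<Phi>_def \<psi>_def v_def at_zero c_def)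
  \<comment> \<open>Comparison with the point x at parameter 1. The gap of 2 \<eta> below F y
    excludes in turn a point z off the tube, t = T' (either would cost M) and t = 0 (there z is
    close to y, where F exceeds F y - \<eta>).\<close>
  then have low: "F z + \<psi> t z \<le> F y - 2 * \<eta>"
    using min[of x] x g(1)[of x] g(2)[of z] \<epsilon>(2) \<eta>(2) \<Phi>z by auto
  have near: "norm (z - (y + t *\<^sub>R v)) < \<rho>"
  proof (rule ccontr)
    assume "\<not> ?thesis"
    then have "\<beta> ((1 / \<rho>) *\<^sub>R (z - (y + t *\<^sub>R v))) = 0"
      using \<rho>(1) by (intro outside) simp
    then have "M \<le> \<psi> t z" using \<psi>_ge[OF t(3), of z] tc_nonneg[OF t(3)] by (simp add: \<psi>_def)
    then show False using low m[OF z] M(2) \<eta>(1) by linarith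
  qed
  have z_ball: "z \<in> ball u R"
    using near \<rho>(2) t T' by (intro near_ball[of t]) auto
  have "t \<noteq> T'"
    using \<psi>_ge[OF t(3), of z] tc_nonneg[OF t(3)] cT' low m[OF z] M(2) \<eta>(1) by auto
  moreover have "t \<noteq> 0"
    using \<psi>_ge[OF t(3), of z] tc_nonneg[OF t(3)] low \<rho>\<^sub>1(2)[OF z] near \<rho>(3) \<eta>(1) by auto
  ultimately have t_int: "0 < t" "t < T'" using t by auto
  define B where "B = \<beta>' ((1 / \<rho>) *\<^sub>R (z - (y + t *\<^sub>R v)))"
  \<comment> \<open>The bump term depends on z - t v only, so its derivative in t is minus its
    derivative in z along v. Criticality in t thereby determines the slope of the bump term along
    v.\<close>
  have crit: "p + c / (T - t)\<^sup>2 + M * (B v / \<rho>) = 0"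
  proof (rule DERIV_local_min)
    have "((\<lambda>t. \<beta> ((1 / \<rho>) *\<^sub>R (z - (y + t *\<^sub>R v)))) has_derivative
        (\<lambda>r. B ((1 / \<rho>) *\<^sub>R - (r *\<^sub>R v)))) (at t)"
      unfolding B_def
      by (rule has_derivative_compose[of "\<lambda>t. (1 / \<rho>) *\<^sub>R (z - (y + t *\<^sub>R v))"
            "\<lambda>r. (1 / \<rho>) *\<^sub>R - (r *\<^sub>R v)" t UNIV \<beta>, OF _ deriv])
        (auto intro!: derivative_eq_intros)
    then have "((\<lambda>t. \<beta> ((1 / \<rho>) *\<^sub>R (z - (y + t *\<^sub>R v)))) has_field_derivative - (B v / \<rho>)) (at t)"
      unfolding has_field_derivative_def
      by (rule has_derivative_eq_rhs) (auto simp: blinfun.bilinear_simps fun_eq_iff)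
    then show "((\<lambda>t. \<psi> t z) has_field_derivative p + c / (T - t)\<^sup>2 + M * (B v / \<rho>)) (at t)"
      unfolding \<psi>_def using t_int T'
      by (auto intro!: derivative_eq_intros simp: power2_eq_square)
    show "0 < min t (T' - t)" using t_int by simp
    show "\<forall>t'. \<bar>t - t'\<bar> < min t (T' - t) \<longrightarrow> \<psi> t z \<le> \<psi> t' z"
    proof (intro allI impI)
      fix t' assume "\<bar>t - t'\<bar> < min t (T' - t)"
      then have "t' \<in> {0..T'}" by auto
      then show "\<psi> t z \<le> \<psi> t' z" unfolding t_def by (rule \<tau>(2))
    qed
  qed
  \<comment> \<open>The parameter is frozen at its value for z: \<psi> t lies above \<Phi> and
    agrees with it at z, so z remains a minimiser.\<close>
  define h where "h w = g w - \<psi> t w" for w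
  define h' where "h' w = g' w + M *\<^sub>R ((1 / \<rho>) *\<^sub>R \<beta>' ((1 / \<rho>) *\<^sub>R (w - (y + t *\<^sub>R v))))" for w
  have "(h has_derivative blinfun_apply (h' w)) (at w)" for w
  proof -
    have "(h has_derivative (\<lambda>k. g' w k - (0 + M * (0 -
        ((1 / \<rho>) *\<^sub>R \<beta>' ((1 / \<rho>) *\<^sub>R (w - (y + t *\<^sub>R v)))) k)))) (at w)"
      unfolding h_def[abs_def] \<psi>_def
      by (intro has_derivative_diff has_derivative_add has_derivative_mult_right
          has_derivative_const g' scaled_has_derivative)
    then show ?thesis
      by (simp add: h'_def plus_blinfun.rep_eq scaleR_blinfun.rep_eq)
  qed
  moreover have "continuous_on UNIV h'"
    unfolding h'_def by (intro continuous_intros g' scaled_deriv_continuous)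
  moreover have "F z - h z \<le> F w - h w" if "w \<in> cball u R" for w
    using min[OF that] \<tau>(2)[OF t(3), of w] \<Phi>z by (simp add: h_def \<Phi>_def)
  moreover have "h' z v \<le> - p + \<delta>"
  proof -
    have "h' z v = g' z v + M * (B v / \<rho>)"
      by (simp add: h'_def B_def blinfun.bilinear_simps)
    also have "\<dots> = g' z v - p - c / (T - t)\<^sup>2" using crit by simp
    also have "\<dots> \<le> g' z v - p" using c by simp
    also have "g' z v \<le> \<delta>"
    proof -
      have "g' z v \<le> norm (g' z) * norm v" using norm_blinfun[of "g' z" v] by simp
      also have "\<dots> \<le> \<epsilon> * (norm v + 1)" using g'(3)[of z] \<epsilon>(1) by (intro mult_mono) auto
      finally show ?thesis using \<epsilon>(3) by simp
    qed
    finally show ?thesis by simp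
  qed
  ultimately show ?thesis
    using z_ball unfolding v_def by blast
qed

end

section \<open>Calculus in charts\<close>

lemma C1_on_subset: "C1_on T f \<Longrightarrow> S \<subseteq> T \<Longrightarrow> C1_on S f"
  unfolding C1_on_def using continuous_on_subset by blast

lemma C1_on_const: "C1_on S (\<lambda>_. k)"
  unfolding C1_on_def by (rule exI[of _ "\<lambda>_. 0"]) (auto simp: zero_blinfun.rep_eq)

lemma C1_on_cong_open:
  assumes "C1_on S f" "open S" "\<And>x. x \<in> S \<Longrightarrow> f x = g x"
  shows "C1_on S g"
proof -
  obtain f' where "\<And>x. x \<in> S \<Longrightarrow> (f has_derivative blinfun_apply (f' x)) (at x)"
    "continuous_on S f'" using assms(1) unfolding C1_on_def by blast
  then show ?thesis
    unfolding C1_on_def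
    by (intro exI[of _ f'])
      (auto intro!: has_derivative_transform_within_open[OF _ assms(2) _ assms(3)])
qed

lemma C1_on_compose:
  assumes g: "C1_on T g" and f: "C1_on S f" and "f ` S \<subseteq> T"
  shows "C1_on S (g \<circ> f)"
proof -
  obtain f' where f': "\<And>x. x \<in> S \<Longrightarrow> (f has_derivative blinfun_apply (f' x)) (at x)"
    "continuous_on S f'" using f unfolding C1_on_def by blast
  obtain g' where g': "\<And>y. y \<in> T \<Longrightarrow> (g has_derivative blinfun_apply (g' y)) (at y)"
    "continuous_on T g'" using g unfolding C1_on_def by blast
  have "continuous_on S f"
    using f'(1) by (meson continuous_at_imp_continuous_on has_derivative_continuous)
  then have "continuous_on S (\<lambda>x. g' (f x) o\<^sub>L f' x)"
    using assms(3)
    by (intro bounded_bilinear.continuous_on[OF bounded_bilinear_blinfun_compose]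
        continuous_on_compose2[OF g'(2)] f'(2))
  moreover have "(g \<circ> f has_derivative blinfun_apply (g' (f x) o\<^sub>L f' x)) (at x)" if "x \<in> S" for x
    using diff_chain_at[OF f'(1)[OF that] g'(1)] that assms(3)
    by (simp add: blinfun_compose.rep_eq image_subset_iff)
  ultimately show ?thesis
    unfolding C1_on_def by (intro exI[of _ "\<lambda>x. g' (f x) o\<^sub>L f' x"]) simp
qed

lemma C1_on_open_Un:
  assumes "open S" "open T" "C1_on S f" "C1_on T f"
  shows "C1_on (S \<union> T) f"
proof -
  obtain f1 where f1: "\<And>x. x \<in> S \<Longrightarrow> (f has_derivative blinfun_apply (f1 x)) (at x)"
    "continuous_on S f1" using assms(3) unfolding C1_on_def by blast
  obtain f2 where f2: "\<And>x. x \<in> T \<Longrightarrow> (f has_derivative blinfun_apply (f2 x)) (at x)"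
    "continuous_on T f2" using assms(4) unfolding C1_on_def by blast
  have eq: "f1 x = f2 x" if "x \<in> S" "x \<in> T" for x
    using has_derivative_unique[OF f1(1) f2(1)] that by (simp add: blinfun_apply_inject)
  define f' where "f' x = (if x \<in> S then f1 x else f2 x)" for x
  have "continuous_on S f'"
    using f1(2) by (rule continuous_on_eq) (simp add: f'_def)
  moreover have "continuous_on T f'"
    using f2(2) by (rule continuous_on_eq) (simp add: f'_def eq)
  ultimately have "continuous_on (S \<union> T) f'"
    using assms(1,2) by (simp add: continuous_on_open_Un)
  moreover have "(f has_derivative blinfun_apply (f' x)) (at x)" if "x \<in> S \<union> T" for x
    using that f1(1) f2(1) by (auto simp: f'_def)
  ultimately show ?thesis
    unfolding C1_on_def by (intro exI[of _ f']) simp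
qed

text \<open>Paracompact Hausdorff spaces are regular. Cover the space by U and the open sets whose
  closure misses x. In a locally finite refinement the members not inside U have closures missing x,
  and local finiteness passes this to the closure of their union; its complement is V.\<close>

lemma paracompact_shrink_open:
  fixes x :: "'a::t2_space"
  assumes pc: "paracompact_space (euclidean :: 'a topology)" and U: "open U" "x \<in> U"
  shows "\<exists>V. open V \<and> x \<in> V \<and> closure V \<subseteq> U"
proof -
  define \<C> where "\<C> = insert U {S. open S \<and> x \<notin> closure S}"
  have "y \<in> \<Union>\<C>" for y
  proof (cases "y = x")
    case False
    then obtain S T where "open S" "open T" "y \<in> S" "x \<in> T" "S \<inter> T = {}"
      using hausdorff[of y x] by blast
    then have "open S" "x \<notin> closure S" "y \<in> S"
      by (auto simp: closure_iff_nhds_not_empty)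
    then show ?thesis by (auto simp: \<C>_def)
  qed (use U in \<open>auto simp: \<C>_def\<close>)
  then have "\<Union>\<C> = UNIV" by blast
  moreover have "\<forall>C\<in>\<C>. open C" using U by (auto simp: \<C>_def)
  moreover have "(\<forall>C\<in>\<C>. openin euclidean C) \<and> \<Union>\<C> = topspace euclidean \<longrightarrow>
      (\<exists>\<D>. (\<forall>D\<in>\<D>. openin euclidean D) \<and> \<Union>\<D> = topspace euclidean \<and>
        (\<forall>D\<in>\<D>. \<exists>C\<in>\<C>. D \<subseteq> C) \<and> locally_finite_in euclidean \<D>)"
    using pc unfolding paracompact_space_def by (rule spec)
  ultimately have "\<exists>\<D>. (\<forall>D\<in>\<D>. open D) \<and> \<Union>\<D> = UNIV \<and> (\<forall>D\<in>\<D>. \<exists>C\<in>\<C>. D \<subseteq> C) \<and>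
      locally_finite_in euclidean \<D>"
    by simp
  then obtain \<D> where \<D>: "\<forall>D\<in>\<D>. open D" "\<Union>\<D> = UNIV"
    "\<forall>D\<in>\<D>. \<exists>C\<in>\<C>. D \<subseteq> C" "locally_finite_in euclidean \<D>"
    by (elim exE conjE)
  define \<E> where "\<E> = {D \<in> \<D>. \<not> D \<subseteq> U}"
  have "x \<notin> closure D" if D: "D \<in> \<E>" for D
  proof -
    obtain C where C: "C \<in> \<C>" "D \<subseteq> C" using \<D>(3) D by (auto simp: \<E>_def)
    with D have "C \<noteq> U" by (auto simp: \<E>_def)
    with C(1) have "x \<notin> closure C" by (simp add: \<C>_def)
    with closure_mono[OF C(2)] show ?thesis by blast
  qed
  moreover have "locally_finite_in euclidean \<E>"
    using \<D>(4) by (rule locally_finite_in_subset) (auto simp: \<E>_def)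
  ultimately have "x \<notin> closure (\<Union>\<E>)"
    using closure_of_locally_finite_Union[of euclidean \<E>] by auto
  moreover have "closure (- closure (\<Union>\<E>)) \<subseteq> U"
  proof
    fix y assume y: "y \<in> closure (- closure (\<Union>\<E>))"
    \<comment> \<open>The member D around y is open and meets V, so it is not among the discarded
      sets and must lie in U.\<close>
    have "y \<in> \<Union>\<D>" by (simp add: \<D>(2))
    then obtain D where D: "D \<in> \<D>" "y \<in> D" by (rule UnionE)
    have "D \<inter> closure (- closure (\<Union>\<E>)) \<noteq> {}" using y D(2) by blast
    moreover have "open D" using D(1) \<D>(1) by blast
    ultimately have "D \<inter> - closure (\<Union>\<E>) \<noteq> {}"
      by (simp only: open_Int_closure_eq_empty simp_thms)
    then have "D \<notin> \<E>" using closure_subset[of "\<Union>\<E>"] by blast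
    with D show "y \<in> U" by (auto simp: \<E>_def)
  qed
  ultimately show ?thesis
    by (intro exI[of _ "- closure (\<Union>\<E>)"]) auto
qed

section \<open>Charts, tangent vectors and differentials\<close>

context C1_Banach_manifold
begin

abbreviation transition_deriv :: "('m, 'x) chart \<Rightarrow> ('m, 'x) chart \<Rightarrow> 'm \<Rightarrow> 'x \<Rightarrow> 'x" where
  "transition_deriv c c' x \<equiv> frechet_derivative (snd c' \<circ> chart_inv c) (at (snd c x))"

text \<open>The expression occurring in \<open>P1_equivalent\<close> and \<open>P2\<close>. By
  \<open>lift_self\<close> and \<open>tangent_vector_eq_lift\<close> it inverts the coordinate map u
  \<mapsto> u c on the tangent space at x.\<close>

abbreviation lift :: "('m, 'x) chart \<Rightarrow> 'm \<Rightarrow> 'x \<Rightarrow> ('m, 'x) tvec" where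
  "lift c x v \<equiv> differential_into A (chart_inv c) (snd c x) v"

lemma chart_homeomorphism:
  "c \<in> A \<Longrightarrow> homeomorphism (fst c) (snd c ` fst c) (snd c) (chart_inv c)"
  using charts unfolding is_chart_def by blast

lemma open_chart_domain: "c \<in> A \<Longrightarrow> open (fst c)"
  using charts unfolding is_chart_def by blast

lemma chart_inv_chart: "c \<in> A \<Longrightarrow> x \<in> fst c \<Longrightarrow> chart_inv c (snd c x) = x"
  using chart_homeomorphism unfolding homeomorphism_def by blast

lemma chart_at: "\<exists>c\<in>A. x \<in> fst c"
  using cover by blast

lemma open_chart_image:
  assumes "c \<in> A" "open S"
  shows "open (snd c ` (fst c \<inter> S))"
proof -
  have "openin (top_of_set (snd c ` fst c)) (snd c ` (fst c \<inter> S))"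
    using assms(2)
    by (intro homeomorphism_imp_open_map[OF chart_homeomorphism[OF assms(1)]]) auto
  moreover have "open (snd c ` fst c)"
    using assms(1) charts unfolding is_chart_def by blast
  ultimately show ?thesis using openin_open_eq by blast
qed

lemma open_chart_preimage:
  assumes "c \<in> A" "open W"
  shows "open {x \<in> fst c. snd c x \<in> W}"
proof -
  have "continuous_on (fst c) (snd c)"
    using chart_homeomorphism[OF assms(1)] unfolding homeomorphism_def by blast
  from continuous_open_preimage[OF this open_chart_domain[OF assms(1)] assms(2)]
  show ?thesis by (simp add: vimage_def Int_def)
qed

lemma C1_transition:
  "c \<in> A \<Longrightarrow> c' \<in> A \<Longrightarrow> C1_on (snd c ` (fst c \<inter> fst c')) (snd c' \<circ> chart_inv c)"
  using compatible unfolding C1_compatible_def by blast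

lemma transition_has_derivative:
  assumes "c \<in> A" "c' \<in> A" "x \<in> fst c" "x \<in> fst c'"
  shows "((snd c' \<circ> chart_inv c) has_derivative transition_deriv c c' x) (at (snd c x))"
proof -
  have "(snd c' \<circ> chart_inv c) differentiable (at (snd c x))"
    using C1_transition[OF assms(1,2)] assms(3,4) unfolding C1_on_def differentiable_def by blast
  then show ?thesis by (simp add: frechet_derivative_works)
qed

text \<open>The chain rule for g \<circ> \<open>chart_inv c'\<close> after the transition map. This
  composite equals g \<circ> \<open>chart_inv c\<close> on the overlap of the charts, which has open
  image and so determines the derivative.\<close>

lemma transition_deriv_chain:
  assumes "c \<in> A" "c' \<in> A" "x \<in> fst c" "x \<in> fst c'"
    and g: "(g \<circ> chart_inv c' has_derivative g') (at (snd c' x))"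
  shows "(g \<circ> chart_inv c has_derivative g' \<circ> transition_deriv c c' x) (at (snd c x))"
proof -
  have "(snd c' \<circ> chart_inv c) (snd c x) = snd c' x"
    using assms by (simp add: chart_inv_chart)
  with g have "((g \<circ> chart_inv c') \<circ> (snd c' \<circ> chart_inv c) has_derivative
      g' \<circ> transition_deriv c c' x) (at (snd c x))"
    by (intro diff_chain_at transition_has_derivative assms) simp
  then show ?thesis
    by (rule has_derivative_transform_within_open[OF _ open_chart_image[OF assms(1)
            open_chart_domain[OF assms(2)]]])
      (use assms in \<open>auto simp: chart_inv_chart\<close>)
qed

lemma transition_deriv_trans:
  assumes "c \<in> A" "c' \<in> A" "c'' \<in> A" "x \<in> fst c" "x \<in> fst c'" "x \<in> fst c''"
  shows "transition_deriv c c'' x v = transition_deriv c' c'' x (transition_deriv c c' x v)"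
proof -
  have "(snd c'' \<circ> chart_inv c has_derivative
      transition_deriv c' c'' x \<circ> transition_deriv c c' x) (at (snd c x))"
    by (intro transition_deriv_chain transition_has_derivative assms)
  from frechet_derivative_at[OF this] show ?thesis by (metis comp_apply)
qed

lemma transition_deriv_self:
  assumes "c \<in> A" "x \<in> fst c"
  shows "transition_deriv c c x v = v"
proof -
  have "(snd c \<circ> chart_inv c has_derivative id) (at (snd c x))"
    by (rule has_derivative_transform_within_open[OF has_derivative_id
          open_chart_image[OF assms(1) open_chart_domain[OF assms(1)]]])
      (use assms in \<open>auto simp: chart_inv_chart\<close>)
  from frechet_derivative_at[OF this] show ?thesis by (metis id_apply)
qed

lemma lift_apply:
  assumes "c \<in> A" "x \<in> fst c"
  shows "lift c x v c' = (if c' \<in> A \<and> x \<in> fst c' then transition_deriv c c' x v else 0)"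
  using assms by (simp add: differential_into_def chart_inv_chart)

lemma lift_in_tangent_space:
  assumes "c \<in> A" "x \<in> fst c"
  shows "lift c x v \<in> tangent_space A x"
  unfolding tangent_space_def
proof (intro CollectI conjI allI ballI impI)
  fix c' assume "\<not> (c' \<in> A \<and> x \<in> fst c')"
  then show "lift c x v c' = 0" by (auto simp: lift_apply[OF assms])
next
  fix c' c'' assume "c' \<in> A" "c'' \<in> A" "x \<in> fst c'" "x \<in> fst c''"
  then show "lift c x v c'' = transition_deriv c' c'' x (lift c x v c')"
    using transition_deriv_trans[OF assms(1) \<open>c' \<in> A\<close> \<open>c'' \<in> A\<close> assms(2), of v]
    by (simp add: lift_apply[OF assms])
qed

lemma lift_self: "c \<in> A \<Longrightarrow> x \<in> fst c \<Longrightarrow> lift c x v c = v"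
  by (simp add: lift_apply transition_deriv_self)

lemma tangent_space_transition:
  assumes "u \<in> tangent_space A x" "c \<in> A" "c' \<in> A" "x \<in> fst c" "x \<in> fst c'"
  shows "u c' = transition_deriv c c' x (u c)"
  by (rule assms(1)[unfolded tangent_space_def, THEN CollectD, THEN conjunct2, rule_format])
    (fact assms)+

lemma tangent_vector_eq_lift:
  assumes "c \<in> A" "x \<in> fst c" "u \<in> tangent_space A x"
  shows "u = lift c x (u c)"
proof
  fix c'
  show "u c' = lift c x (u c) c'"
  proof (cases "c' \<in> A \<and> x \<in> fst c'")
    case True
    then show ?thesis
      using tangent_space_transition[OF assms(3,1) _ assms(2), of c'] by (simp add: lift_apply assms)
  next
    case False
    then have "u c' = 0" using assms(3) unfolding tangent_space_def by blast
    with False show ?thesis by (auto simp: lift_apply assms)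
  qed
qed

lemma lift_add:
  assumes "c \<in> A" "x \<in> fst c"
  shows "lift c x (v + w) = (\<lambda>c'. lift c x v c' + lift c x w c')"
  using linear_add[OF has_derivative_linear[OF transition_has_derivative[OF assms(1) _ assms(2)]]]
  by (intro ext) (simp add: lift_apply assms)

lemma lift_scaleR:
  assumes "c \<in> A" "x \<in> fst c"
  shows "lift c x (r *\<^sub>R v) = (\<lambda>c'. r *\<^sub>R lift c x v c')"
  using linear_scale[OF has_derivative_linear[OF transition_has_derivative[OF assms(1) _ assms(2)]]]
  by (intro ext) (simp add: lift_apply assms)

lemma C1_function_has_derivative:
  assumes "C1_function A g" "c \<in> A" "x \<in> fst c"
  shows "(g \<circ> chart_inv c has_derivative frechet_derivative (g \<circ> chart_inv c) (at (snd c x)))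
    (at (snd c x))"
proof -
  have "(g \<circ> chart_inv c) differentiable (at (snd c x))"
    using assms unfolding C1_function_def C1_on_def differentiable_def by blast
  then show ?thesis by (simp add: frechet_derivative_works)
qed

text \<open>Frees \<open>differential\<close> from the chart picked by \<open>SOME\<close>: the
  transition derivative produced by the chain rule is the one that changes the coordinates of
  u.\<close>

lemma differential_eq:
  assumes g: "C1_function A g" and c: "c \<in> A" "x \<in> fst c" and u: "u \<in> tangent_space A x"
  shows "differential A g x u = frechet_derivative (g \<circ> chart_inv c) (at (snd c x)) (u c)"
proof -
  define c' where "c' = (SOME c. c \<in> A \<and> x \<in> fst c)"
  have c': "c' \<in> A" "x \<in> fst c'"
    unfolding c'_def using someI_ex[OF chart_at[of x, unfolded Bex_def]] by auto
  have "(g \<circ> chart_inv c has_derivative frechet_derivative (g \<circ> chart_inv c') (at (snd c' x)) \<circ>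
      transition_deriv c c' x) (at (snd c x))"
    by (intro transition_deriv_chain C1_function_has_derivative g c c')
  from frechet_derivative_at[OF this]
  have "frechet_derivative (g \<circ> chart_inv c) (at (snd c x)) (u c) =
      frechet_derivative (g \<circ> chart_inv c') (at (snd c' x)) (transition_deriv c c' x (u c))"
    by (metis comp_apply)
  moreover have "u c' = transition_deriv c c' x (u c)"
    by (intro tangent_space_transition u c c')
  ultimately show ?thesis
    using u unfolding differential_def c'_def[symmetric] by simp
qed

section \<open>Extending functions from a chart to the manifold\<close>

lemma closed_in_chart_closed:
  assumes "c \<in> A" "closed C" "{x \<in> fst c. snd c x \<in> C} \<subseteq> V" "closure V \<subseteq> fst c"
  shows "closed {x \<in> fst c. snd c x \<in> C}"
proof -
  have "continuous_on (fst c) (snd c)"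
    using chart_homeomorphism[OF assms(1)] unfolding homeomorphism_def by simp
  then have "closedin (top_of_set (fst c)) (fst c \<inter> snd c -` C)"
    using assms(2) by (rule continuous_closedin_preimage)
  then obtain D where D: "closed D" "fst c \<inter> snd c -` C = fst c \<inter> D"
    by (auto simp: closedin_closed)
  have eq: "{x \<in> fst c. snd c x \<in> C} = fst c \<inter> D" using D(2) by auto
  \<comment> \<open>The set is only relatively closed in the chart domain; being trapped in V, it
    can be cut out of \<open>closure V\<close> instead, which is closed in the manifold.\<close>
  moreover have "fst c \<inter> D = closure V \<inter> D"
    using assms(3,4) closure_subset[of V] unfolding eq by auto
  ultimately show ?thesis using D(1) by (simp add: closed_Int)
qed

text \<open>In infinite dimension a closed ball in a chart need not be closed in the manifold, hence the set
  \<open>V\<close> whose closure stays inside the chart domain.\<close>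

lemma C1_function_zero_extension:
  fixes H :: "'x \<Rightarrow> real"
  assumes c: "c \<in> A" and H: "C1_on UNIV H" and C: "closed C" "\<And>w. w \<notin> C \<Longrightarrow> H w = 0"
    and V: "{x \<in> fst c. snd c x \<in> C} \<subseteq> V" "closure V \<subseteq> fst c"
  shows "C1_function A (\<lambda>y. if y \<in> fst c then H (snd c y) else 0)"
  unfolding C1_function_def
proof
  define E where "E = {x \<in> fst c. snd c x \<in> C}"
  let ?G = "\<lambda>y. if y \<in> fst c then H (snd c y) else 0"
  fix c' assume c': "c' \<in> A"
  have "closed E" unfolding E_def by (rule closed_in_chart_closed[OF c C(1) V])
  then have "open (- E)" by (rule open_Compl)
  \<comment> \<open>On S the function is H in the coordinates of c, on T it is zero. The two open
    sets cover the image of c', since E lies in the domain of c.\<close>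
  define S T where "S = snd c' ` (fst c' \<inter> fst c)" and "T = snd c' ` (fst c' \<inter> - E)"
  have "open S" "open T"
    unfolding S_def T_def
    by (intro open_chart_image c' open_chart_domain c \<open>open (- E)\<close>)+
  moreover have "C1_on S (?G \<circ> chart_inv c')"
  proof (rule C1_on_cong_open[OF _ \<open>open S\<close>])
    show "C1_on S (H \<circ> (snd c \<circ> chart_inv c'))"
      using C1_transition[OF c' c] H unfolding S_def by (intro C1_on_compose[of UNIV]) auto
  qed (auto simp: S_def chart_inv_chart c')
  moreover have "C1_on T (?G \<circ> chart_inv c')"
  proof (rule C1_on_cong_open[OF C1_on_const \<open>open T\<close>, of 0])
    fix w assume "w \<in> T"
    then obtain y where y: "w = snd c' y" "y \<in> fst c'" "y \<in> fst c \<longrightarrow> snd c y \<notin> C"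
      unfolding T_def E_def by blast
    then have "y \<in> fst c \<longrightarrow> H (snd c y) = 0" using C(2) by simp
    then show "0 = (?G \<circ> chart_inv c') w"
      using y(1,2) chart_inv_chart[OF c'] by simp
  qed
  ultimately have "C1_on (S \<union> T) (?G \<circ> chart_inv c')"
    by (rule C1_on_open_Un)
  moreover have "snd c' ` fst c' \<subseteq> S \<union> T"
    unfolding S_def T_def E_def by auto
  ultimately show "C1_on (snd c' ` fst c') (?G \<circ> chart_inv c')"
    by (rule C1_on_subset)
qed

lemma eventually_chart:
  assumes c: "c \<in> A" "x \<in> fst c" and P: "\<forall>\<^sub>F w in nhds (snd c x). P w"
  shows "\<forall>\<^sub>F y in nhds x. y \<in> fst c \<and> P (snd c y)"
proof -
  obtain S where S: "open S" "snd c x \<in> S" "\<forall>w\<in>S. P w"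
    using P unfolding eventually_nhds by auto
  then have "open {y \<in> fst c. snd c y \<in> S}" "x \<in> {y \<in> fst c. snd c y \<in> S}"
    using open_chart_preimage[OF c(1)] c(2) by auto
  then show ?thesis
    unfolding eventually_nhds using S(3) by (intro exI[of _ "{y \<in> fst c. snd c y \<in> S}"]) auto
qed

text \<open>\<open>subdifferential\<close> asks for test functions on the whole manifold, whereas h
  lives in one chart. A cutoff inside V followed by extension by zero makes it global without
  changing its derivative at x.\<close>

lemma subgradient_of_chart_minimum:
  fixes f :: "'m \<Rightarrow> real" and h :: "'x \<Rightarrow> real"
  assumes bump: "C1_unit_bump (\<beta> :: 'x \<Rightarrow> real) \<beta>' L"
    and c: "c \<in> A" and V: "open V" "closure V \<subseteq> fst c" and x: "x \<in> V"
    and h: "\<And>w. (h has_derivative blinfun_apply (h' w)) (at w)" "continuous_on UNIV h'"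
    and min: "\<forall>\<^sub>F y in nhds x. f x - h (snd c x) \<le> f y - h (snd c y)"
  shows "\<exists>G. C1_function A G \<and> differential A G x \<in> subdifferential A f x \<and>
    (\<forall>v. differential A G x (lift c x v) = h' (snd c x) v)"
proof -
  interpret C1_unit_bump \<beta> \<beta>' L by (rule bump)
  have xc: "x \<in> fst c" "V \<subseteq> fst c" using x V(2) closure_subset[of V] by auto
  define z where "z = snd c x"
  have "open (snd c ` (fst c \<inter> V))" by (rule open_chart_image[OF c V(1)])
  moreover have "z \<in> snd c ` (fst c \<inter> V)" using x xc by (auto simp: z_def)
  ultimately obtain \<rho> where \<rho>: "0 < \<rho>" "cball z \<rho> \<subseteq> snd c ` (fst c \<inter> V)"
    by (auto dest: open_contains_cball[THEN iffD1, rule_format])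
  \<comment> \<open>Since the cutoff \<open>\<beta>\<close> is at most 1, with equality at the centre, \<open>k \<cdot> \<beta> \<le> k\<close> near \<open>z\<close>, where \<open>k\<close>
    is positive; so the product still supports \<open>f\<close> from below and keeps the derivative of \<open>h\<close>.\<close>
  define k where "k w = h w - h z + 1" for w
  define H where "H w = k w * \<beta> ((1 / \<rho>) *\<^sub>R (w - z))" for w
  define H' where "H' w = k w *\<^sub>R ((1 / \<rho>) *\<^sub>R \<beta>' ((1 / \<rho>) *\<^sub>R (w - z))) +
    \<beta> ((1 / \<rho>) *\<^sub>R (w - z)) *\<^sub>R h' w" for w
  have k_deriv: "(k has_derivative blinfun_apply (h' w)) (at w)" for w
    unfolding k_def[abs_def] by (auto intro!: derivative_eq_intros h)
  have H_deriv: "(H has_derivative blinfun_apply (H' w)) (at w)" for w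
    unfolding H_def[abs_def]
    by (rule has_derivative_eq_rhs[OF has_derivative_mult[OF k_deriv scaled_has_derivative]])
      (auto simp: H'_def fun_eq_iff blinfun.bilinear_simps)
  have "continuous_on UNIV k"
    using k_deriv by (meson continuous_at_imp_continuous_on has_derivative_continuous)
  then have "continuous_on UNIV H'"
    unfolding H'_def
    by (intro continuous_intros h(2) scaled_deriv_continuous
        continuous_on_compose2[OF continuous_on_bump[of UNIV]]) auto
  then have H_C1: "C1_on UNIV H"
    unfolding C1_on_def using H_deriv by (intro exI[of _ H']) simp
  define G where "G y = (if y \<in> fst c then H (snd c y) else 0)" for y
  have "{y \<in> fst c. snd c y \<in> cball z \<rho>} \<subseteq> V"
  proof
    fix y assume "y \<in> {y \<in> fst c. snd c y \<in> cball z \<rho>}"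
    then obtain y' where "y \<in> fst c" "y' \<in> fst c" "y' \<in> V" "snd c y = snd c y'"
      using \<rho>(2) by auto
    then show "y \<in> V" using chart_inv_chart[OF c] by metis
  qed
  moreover have "H w = 0" if "w \<notin> cball z \<rho>" for w
    using that \<rho>(1) outside[of "(1 / \<rho>) *\<^sub>R (w - z)"]
    by (simp add: H_def dist_norm norm_minus_commute)
  ultimately have G_C1: "C1_function A G"
    unfolding G_def[abs_def] using V(2)
    by (intro C1_function_zero_extension[OF c H_C1 closed_cball]) auto
  have "(G \<circ> chart_inv c has_derivative blinfun_apply (H' z)) (at z)"
  proof (rule has_derivative_transform_within_open[OF H_deriv])
    show "open (snd c ` fst c)" using open_chart_image[OF c, of UNIV] by simp
    show "z \<in> snd c ` fst c" using xc by (simp add: z_def)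
  qed (auto simp: G_def chart_inv_chart c)
  then have "frechet_derivative (G \<circ> chart_inv c) (at z) = blinfun_apply (H' z)"
    by (rule frechet_derivative_at[symmetric])
  also have "H' z = h' z" by (simp add: H'_def deriv_at_zero at_zero)
  finally have G_diff: "differential A G x (lift c x v) = h' (snd c x) v" for v
    using differential_eq[OF G_C1 c xc(1) lift_in_tangent_space[OF c xc(1)]] lift_self[OF c xc(1)]
    by (simp only: z_def)
  have "isCont k z" using k_deriv by (rule has_derivative_continuous)
  then have "(k \<longlongrightarrow> k z) (nhds z)"
    unfolding isCont_def tendsto_at_iff_tendsto_nhds .
  then have "\<forall>\<^sub>F w in nhds z. 0 < k w"
    by (rule order_tendstoD(1)) (simp add: k_def)
  then have "\<forall>\<^sub>F y in nhds x. y \<in> fst c \<and> 0 < k (snd c y)"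
    unfolding z_def by (rule eventually_chart[OF c xc(1)])
  with min have "\<forall>\<^sub>F y in nhds x. f x - G x \<le> f y - G y"
  proof eventually_elim
    case (elim y)
    have "G x = 1" using xc by (simp add: G_def H_def k_def z_def at_zero)
    moreover have "G y \<le> k (snd c y) * 1"
      using elim le_one unfolding G_def H_def by (auto intro!: mult_left_mono)
    ultimately show ?case using elim(1) by (simp add: k_def z_def)
  qed
  then have "differential A G x \<in> subdifferential A f x"
    unfolding subdifferential_def using G_C1 by auto
  with G_C1 G_diff show ?thesis by blast
qed

end

section \<open>Bounding subgradients by the Finsler norm\<close>

context C1_Finsler_manifold
begin

lemma N_nonneg: "u \<in> tangent_space A x \<Longrightarrow> 0 \<le> N x u"
  using P1_norm[of x] unfolding is_norm_on_tangent_space_def by simp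

lemma N_lift_nonneg: "c \<in> A \<Longrightarrow> x \<in> fst c \<Longrightarrow> 0 \<le> N x (lift c x v)"
  by (intro N_nonneg lift_in_tangent_space)

lemma N_scaleR: "u \<in> tangent_space A x \<Longrightarrow> N x (\<lambda>c. r *\<^sub>R u c) = \<bar>r\<bar> * N x u"
  using P1_norm[of x] unfolding is_norm_on_tangent_space_def by simp

lemma N_lift_scaleR:
  "c \<in> A \<Longrightarrow> x \<in> fst c \<Longrightarrow> N x (lift c x (r *\<^sub>R v)) = \<bar>r\<bar> * N x (lift c x v)"
  by (simp only: lift_scaleR N_scaleR lift_in_tangent_space)

lemma N_lift_triangle:
  assumes "c \<in> A" "x \<in> fst c"
  shows "N x (lift c x (v + w)) \<le> N x (lift c x v) + N x (lift c x w)"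
  using P1_norm[of x] lift_in_tangent_space[OF assms]
  unfolding is_norm_on_tangent_space_def lift_add[OF assms] by simp

lemma N_lift_bounds:
  assumes "c \<in> A" "x \<in> fst c"
  obtains a b where "0 < a" "0 < b" "\<And>v. a * norm v \<le> N x (lift c x v)"
    "\<And>v. N x (lift c x v) \<le> b * norm v"
  using P1_equivalent[OF assms] unfolding equivalent_to_norm_def by auto

text \<open>A real supremum says something only about a bounded set: boundedness comes from the
  bounded coordinate derivative and the equivalence of \<open>N x\<close> with the model norm. The
  estimate then follows by normalising v.\<close>

lemma differential_le_dual_norm:
  assumes G: "C1_function A G" and K: "dual_norm A N x (differential A G x) \<le> K"
    and c: "c \<in> A" "x \<in> fst c"
  shows "\<bar>differential A G x (lift c x v)\<bar> \<le> K * N x (lift c x v)"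
proof -
  define D where "D = frechet_derivative (G \<circ> chart_inv c) (at (snd c x))"
  have D: "(G \<circ> chart_inv c has_derivative D) (at (snd c x))"
    unfolding D_def by (rule C1_function_has_derivative[OF G c])
  have dG: "differential A G x (lift c x w) = D w" for w
    using differential_eq[OF G c lift_in_tangent_space[OF c]] lift_self[OF c] by (simp add: D_def)
  obtain a b where ab: "0 < a" "\<And>w. a * norm w \<le> N x (lift c x w)"
    using N_lift_bounds[OF c] by metis
  obtain B where B: "\<And>w. \<bar>D w\<bar> \<le> norm w * B" "0 \<le> B"
    using bounded_linear.nonneg_bounded[OF has_derivative_bounded_linear[OF D]] by auto
  have bdd: "bdd_above {\<bar>differential A G x u\<bar> |u. u \<in> tangent_space A x \<and> N x u = 1}"
  proof (rule bdd_aboveI)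
    fix r assume "r \<in> {\<bar>differential A G x u\<bar> |u. u \<in> tangent_space A x \<and> N x u = 1}"
    then obtain u where u: "u \<in> tangent_space A x" "N x u = 1" "r = \<bar>differential A G x u\<bar>"
      by blast
    have ul: "u = lift c x (u c)" using tangent_vector_eq_lift[OF c u(1)] .
    have "a * norm (u c) \<le> 1" using ab(2)[of "u c"] u(2) ul by simp
    then have "norm (u c) \<le> 1 / a" using ab(1) by (simp add: field_simps)
    then have "norm (u c) * B \<le> 1 / a * B" using B(2) by (rule mult_right_mono)
    moreover have "r = \<bar>D (u c)\<bar>" using dG[of "u c"] ul u(3) by simp
    ultimately show "r \<le> 1 / a * B" using B(1)[of "u c"] by linarith
  qed
  define s where "s = N x (lift c x v)"
  show ?thesis
  proof (cases "v = 0")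
    case True
    have "s = 0" using N_lift_scaleR[OF c, of 0 v] True by (simp add: s_def)
    moreover have "D v = 0" using True linear_0[OF has_derivative_linear[OF D]] by simp
    ultimately show ?thesis by (simp add: dG s_def)
  next
    case False
    then have s: "0 < s" using ab(1) ab(2)[of v] unfolding s_def
      by (smt (verit) mult_pos_pos zero_less_norm_iff)
    have "N x (lift c x ((1 / s) *\<^sub>R v)) = 1"
      using s N_lift_scaleR[OF c, of "1 / s" v] by (simp add: s_def[symmetric])
    then have "\<bar>differential A G x (lift c x ((1 / s) *\<^sub>R v))\<bar>
        \<in> {\<bar>differential A G x u\<bar> |u. u \<in> tangent_space A x \<and> N x u = 1}"
      using lift_in_tangent_space[OF c] by blast
    from cSup_upper[OF this bdd] K have "\<bar>D ((1 / s) *\<^sub>R v)\<bar> \<le> K"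
      unfolding dual_norm_def by (simp add: dG)
    then have "\<bar>D v\<bar> / s \<le> K"
      using s by (simp add: linear_scale[OF has_derivative_linear[OF D]])
    then show ?thesis using s by (simp add: dG s_def[symmetric] field_simps)
  qed
qed

theorem locally_Lipschitz_in_chart:
  fixes f :: "'m \<Rightarrow> real"
  assumes bump: "C1_unit_bump (\<beta> :: 'x \<Rightarrow> real) \<beta>' L" and f: "lower_semicontinuous f"
    and K: "\<And>x \<xi>. \<xi> \<in> subdifferential A f x \<Longrightarrow> dual_norm A N x \<xi> \<le> K"
    and c: "c \<in> A" "x\<^sub>0 \<in> fst c" and \<epsilon>: "0 < \<epsilon>"
  shows "\<exists>R>0. ball (snd c x\<^sub>0) R \<subseteq> snd c ` fst c \<and>
    (\<forall>u\<in>ball (snd c x\<^sub>0) R. \<forall>w\<in>ball (snd c x\<^sub>0) R. f (chart_inv c u) - f (chart_inv c w)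
      \<le> max K 0 * (1 + \<epsilon>) * N x\<^sub>0 (lift c x\<^sub>0 (w - u)))"
proof -
  interpret C1_unit_bump \<beta> \<beta>' L by (rule bump)
  obtain V where V: "open V" "x\<^sub>0 \<in> V" "closure V \<subseteq> fst c"
    using paracompact_shrink_open[OF paracompact open_chart_domain[OF c(1)] c(2)] by auto
  obtain W where W: "open W" "x\<^sub>0 \<in> W"
    "\<And>x v. x \<in> W \<Longrightarrow> N x (lift c x v) \<le> (1 + \<epsilon>) * N x\<^sub>0 (lift c x\<^sub>0 v)"
    using P2[OF \<epsilon> c] by blast
  obtain O1 where O1: "open O1" "x\<^sub>0 \<in> O1" "\<And>y. y \<in> O1 \<Longrightarrow> f x\<^sub>0 - 1 < f y"
    using f[unfolded lower_semicontinuous_def, rule_format, of "f x\<^sub>0 - 1" x\<^sub>0]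
    unfolding eventually_nhds by auto
  \<comment> \<open>V allows the global extension, W compares the norms with the one at
    \<open>x\<^sub>0\<close>, and O1 bounds f from below.\<close>
  define O2 where "O2 = V \<inter> W \<inter> O1"
  have "open (snd c ` (fst c \<inter> O2))"
    unfolding O2_def by (intro open_chart_image c(1) open_Int V W O1)
  moreover have "snd c x\<^sub>0 \<in> snd c ` (fst c \<inter> O2)"
    using c V W O1 by (auto simp: O2_def)
  ultimately obtain R where R: "0 < R" "cball (snd c x\<^sub>0) R \<subseteq> snd c ` (fst c \<inter> O2)"
    by (auto dest: open_contains_cball[THEN iffD1, rule_format])
  define F where "F w = f (chart_inv c w)" for w
  have inv: "chart_inv c w \<in> fst c \<inter> O2" "snd c (chart_inv c w) = w"
    if "w \<in> cball (snd c x\<^sub>0) R" for w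
    using that R(2) chart_inv_chart[OF c(1)] by auto
  have "lsc_on (cball (snd c x\<^sub>0) R) F"
    unfolding lsc_on_def
  proof (intro ballI allI impI)
    fix w a assume w: "w \<in> cball (snd c x\<^sub>0) R" and a: "a < F w"
    have "continuous_on (snd c ` fst c) (chart_inv c)"
      using chart_homeomorphism[OF c(1)] unfolding homeomorphism_def by simp
    then have "continuous_on (cball (snd c x\<^sub>0) R) (chart_inv c)"
      by (rule continuous_on_subset) (use R(2) in auto)
    then have "(chart_inv c \<longlongrightarrow> chart_inv c w) (at w within cball (snd c x\<^sub>0) R)"
      using w unfolding continuous_on_def by simp
    moreover have "\<forall>\<^sub>F y in nhds (chart_inv c w). a < f y"
      using f a unfolding lower_semicontinuous_def F_def by simp
    ultimately show "\<forall>\<^sub>F w in at w within cball (snd c x\<^sub>0) R. a < F w"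
      unfolding F_def by (rule eventually_compose_filterlim[rotated])
  qed
  note steep = steep_subgradient_exists[OF _ _ this, of _ _ "f x\<^sub>0 - 1"]
  have "F u - F w \<le> max K 0 * (1 + \<epsilon>) * N x\<^sub>0 (lift c x\<^sub>0 (w - u))"
    if u: "u \<in> ball (snd c x\<^sub>0) R" and w: "w \<in> ball (snd c x\<^sub>0) R" for u w
  proof (rule ccontr)
    assume neg: "\<not> ?thesis"
    define q where "q = max K 0 * (1 + \<epsilon>) * N x\<^sub>0 (lift c x\<^sub>0 (w - u))"
    \<comment> \<open>A third of the excess: prescribing slope q + 2 \<delta> with error \<delta>
      still leaves a subgradient with slope below - q.\<close>
    define \<delta> where "\<delta> = (F u - F w - q) / 3"
    have \<delta>: "0 < \<delta>" "F w + (q + 2 * \<delta>) < F u"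
      using neg unfolding q_def[symmetric] \<delta>_def by (auto simp: field_simps)
    have q: "0 \<le> q" unfolding q_def using \<epsilon> N_lift_nonneg[OF c] by simp
    have "f x\<^sub>0 - 1 \<le> F z" if "z \<in> cball (snd c x\<^sub>0) R" for z
      using inv(1)[OF that] O1(3) by (auto simp: F_def O2_def less_imp_le)
    moreover have "0 \<le> q + 2 * \<delta>" using q \<delta>(1) by simp
    ultimately obtain h h' z where z: "z \<in> ball (snd c x\<^sub>0) R"
      and h: "\<And>w. (h has_derivative blinfun_apply (h' w)) (at w)" "continuous_on UNIV h'"
      and min: "\<And>w. w \<in> cball (snd c x\<^sub>0) R \<Longrightarrow> F z - h z \<le> F w - h w"
      and slope: "blinfun_apply (h' z) (w - u) \<le> - (q + 2 * \<delta>) + \<delta>"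
      using steep[OF w u _ _ \<delta>(2) \<delta>(1)] by blast
    define x where "x = chart_inv c z"
    have zc: "z \<in> cball (snd c x\<^sub>0) R" using z ball_subset_cball by blast
    have x: "x \<in> fst c" "x \<in> V" "x \<in> W" "snd c x = z"
      using inv[OF zc] by (auto simp: x_def O2_def)
    have "\<forall>\<^sub>F w in nhds z. w \<in> ball (snd c x\<^sub>0) R"
      using z by (intro eventually_nhds_in_open) auto
    then have "\<forall>\<^sub>F y in nhds x. y \<in> fst c \<and> snd c y \<in> ball (snd c x\<^sub>0) R"
      unfolding x(4)[symmetric] by (rule eventually_chart[OF c(1) x(1)])
    then have "\<forall>\<^sub>F y in nhds x. f x - h (snd c x) \<le> f y - h (snd c y)"
    proof eventually_elim
      case (elim y)
      then show ?case
        using min[of "snd c y"] chart_inv_chart[OF c(1), of y] x(4)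
        by (simp add: F_def x_def)
    qed
    then obtain G where G: "C1_function A G" "differential A G x \<in> subdifferential A f x"
      "\<And>v. differential A G x (lift c x v) = h' (snd c x) v"
      using subgradient_of_chart_minimum[OF bump c(1) V(1,3) x(2) h] by blast
    \<comment> \<open>The dual norm bound at x, carried over to the norm at
      \<open>x\<^sub>0\<close>, caps the slope by q. Replacing K by \<open>max K 0\<close> keeps the
      norm comparison monotone.\<close>
    have "\<bar>h' z (w - u)\<bar> \<le> K * N x (lift c x (w - u))"
      using differential_le_dual_norm[OF G(1) K[OF G(2)] c(1) x(1), of "w - u"] G(3)[of "w - u"]
      by (simp add: x(4))
    also have "\<dots> \<le> max K 0 * N x (lift c x (w - u))"
      by (intro mult_right_mono N_lift_nonneg c x) simp
    also have "\<dots> \<le> max K 0 * ((1 + \<epsilon>) * N x\<^sub>0 (lift c x\<^sub>0 (w - u)))"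
      by (intro mult_left_mono W(3) x) simp
    also have "\<dots> = q" by (simp add: q_def)
    finally show False using slope q \<delta>(1) by linarith
  qed
  moreover have "ball (snd c x\<^sub>0) R \<subseteq> snd c ` fst c"
    using R(2) ball_subset_cball[of "snd c x\<^sub>0" R] by blast
  ultimately show ?thesis
    using R(1) unfolding F_def by (intro exI[of _ R]) simp
qed

end

section \<open>Paths\<close>

text \<open>The fundamental theorem is not at hand for h, which only has bounded difference
  quotients. With an error e (t - s) added, the estimate is additive over adjacent intervals and
  true on all short intervals around each point, so bisection gives it on [a,b]; then e tends to
  0.\<close>

lemma increment_le_integral:
  fixes h \<sigma> :: "real \<Rightarrow> real"
  assumes ab: "a \<le> b" and \<sigma>: "continuous_on {a..b} \<sigma>"
    and loc: "\<And>t e. t \<in> {a..b} \<Longrightarrow> 0 < e \<Longrightarrow>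
      \<exists>d>0. \<forall>s\<in>{a..b}. \<bar>s - t\<bar> < d \<longrightarrow> \<bar>h s - h t\<bar> \<le> (\<sigma> t + e) * \<bar>s - t\<bar>"
  shows "\<bar>h b - h a\<bar> \<le> integral {a..b} \<sigma>"
proof -
  define H where "H u = integral {a..u} \<sigma>" for u
  have "\<bar>h b - h a\<bar> \<le> H b - H a + e * (b - a)" if e: "0 < e" for e
  proof -
    define P where "P s t \<longleftrightarrow> (a \<le> s \<longrightarrow> t \<le> b \<longrightarrow> \<bar>h t - h s\<bar> \<le> H t - H s + e * (t - s))" for s t
    have "P a b"
      using ab
    proof (induction rule: Bolzano)
      case (trans s m t)
      then show ?case unfolding P_def by (auto simp: algebra_simps)
    next
      case (local x)
      then have x: "x \<in> {a..b}" by simp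
      \<comment> \<open>Half of e pays for the difference quotients of h, half for replacing
        \<sigma> x by increments of its integral. Both are centred at x, which lies between s and
        t.\<close>
      obtain d1 where d1: "0 < d1" "\<And>s. s \<in> {a..b} \<Longrightarrow> \<bar>s - x\<bar> < d1 \<Longrightarrow>
          \<bar>h s - h x\<bar> \<le> (\<sigma> x + e / 2) * \<bar>s - x\<bar>"
        using loc[OF x, of "e / 2"] e by auto
      have "(H has_vector_derivative \<sigma> x) (at x within {a..b})"
        unfolding H_def by (rule integral_has_vector_derivative[OF \<sigma> x])
      then obtain d2 where d2: "0 < d2" "\<And>s. s \<in> {a..b} \<Longrightarrow> \<bar>s - x\<bar> < d2 \<Longrightarrow>
          \<bar>H s - H x - (s - x) * \<sigma> x\<bar> \<le> e / 2 * \<bar>s - x\<bar>"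
        using e unfolding has_vector_derivative_def has_derivative_within_alt
        by (auto dest!: spec[of _ "e / 2"])
      show ?case
      proof (intro exI[of _ "min d1 d2"] conjI allI impI)
        fix s t assume st: "s \<le> x \<and> x \<le> t \<and> t - s < min d1 d2"
        show "P s t"
          unfolding P_def
        proof (intro impI)
          assume "a \<le> s" "t \<le> b"
          then have "s \<in> {a..b}" "t \<in> {a..b}" "\<bar>s - x\<bar> = x - s" "\<bar>t - x\<bar> = t - x"
            "\<bar>s - x\<bar> < d1" "\<bar>s - x\<bar> < d2" "\<bar>t - x\<bar> < d1" "\<bar>t - x\<bar> < d2"
            using st by auto
          then have *: "\<bar>h s - h x\<bar> \<le> (\<sigma> x + e / 2) * (x - s)"
            "\<bar>h t - h x\<bar> \<le> (\<sigma> x + e / 2) * (t - x)"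
            "\<bar>H s - H x - (s - x) * \<sigma> x\<bar> \<le> e / 2 * (x - s)"
            "\<bar>H t - H x - (t - x) * \<sigma> x\<bar> \<le> e / 2 * (t - x)"
            using d1(2)[of s] d1(2)[of t] d2(2)[of s] d2(2)[of t] by simp_all
          define p q where "p = x - s" and "q = t - x"
          have "\<bar>h s - h x\<bar> \<le> \<sigma> x * p + e * p / 2" "\<bar>h t - h x\<bar> \<le> \<sigma> x * q + e * q / 2"
            "\<bar>H s - H x + \<sigma> x * p\<bar> \<le> e * p / 2" "\<bar>H t - H x - \<sigma> x * q\<bar> \<le> e * q / 2"
            using * by (simp_all add: p_def q_def field_simps)
          moreover have "e * (t - s) = e * p + e * q" by (simp add: p_def q_def algebra_simps)
          ultimately show "\<bar>h t - h s\<bar> \<le> H t - H s + e * (t - s)" by linarith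
        qed
      qed (use d1 d2 in auto)
    qed
    then show ?thesis by (simp add: P_def)
  qed
  moreover have "H a = 0" by (simp add: H_def)
  ultimately have "\<bar>h b - h a\<bar> \<le> H b + e" if "0 < e" for e
  proof -
    \<comment> \<open>Adding 1 to the length avoids a zero denominator when a = b.\<close>
    have "e / (b - a + 1) * (b - a) \<le> e"
      using that ab by (simp add: divide_simps mult_left_mono)
    moreover have "0 < e / (b - a + 1)" using that ab by simp
    ultimately show ?thesis
      using \<open>\<And>e. 0 < e \<Longrightarrow> \<bar>h b - h a\<bar> \<le> H b - H a + e * (b - a)\<close>[of "e / (b - a + 1)"] \<open>H a = 0\<close>
      by linarith
  qed
  then show ?thesis
    unfolding H_def by (rule field_le_epsilon)
qed

section \<open>Velocity of a C^1 path\<close>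

lemma vector_derivative_within_Icc:
  fixes f :: "real \<Rightarrow> 'a::real_normed_vector"
  assumes "a < b" "t \<in> {a..b}" "(f has_vector_derivative f') (at t within {a..b})"
  shows "vector_derivative f (at t within {a..b}) = f'"
  using assms by (intro vector_derivative_within) (simp_all add: trivial_limit_within islimpt_Icc)

lemma C1_path_on_cong:
  assumes "C1_path_on A a b \<gamma>" "\<And>t. t \<in> {a..b} \<Longrightarrow> \<gamma> t = \<delta> t"
  shows "C1_path_on A a b \<delta>"
  unfolding C1_path_on_def
proof (intro conjI ballI)
  show "continuous_on {a..b} \<delta>"
    using assms unfolding C1_path_on_def by (metis continuous_on_eq)
  fix c assume "c \<in> A"
  then obtain D where D: "continuous_on {t \<in> {a..b}. \<gamma> t \<in> fst c} D"
    "\<And>t. t \<in> {a..b} \<Longrightarrow> \<gamma> t \<in> fst c \<Longrightarrow> (snd c \<circ> \<gamma> has_vector_derivative D t) (at t within {a..b})"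
    using assms(1) unfolding C1_path_on_def by blast
  have eq: "{t \<in> {a..b}. \<delta> t \<in> fst c} = {t \<in> {a..b}. \<gamma> t \<in> fst c}"
    using assms(2) by auto
  have "(snd c \<circ> \<delta> has_vector_derivative D t) (at t within {a..b})"
    if "t \<in> {a..b}" "\<delta> t \<in> fst c" for t
  proof (rule has_vector_derivative_transform[OF that(1)])
    show "(snd c \<circ> \<gamma> has_vector_derivative D t) (at t within {a..b})"
      using D(2) that assms(2) by simp
  qed (simp add: assms(2))
  with D(1) show "\<exists>D. continuous_on {t \<in> {a..b}. \<delta> t \<in> fst c} D \<and>
      (\<forall>t\<in>{a..b}. \<delta> t \<in> fst c \<longrightarrow> (snd c \<circ> \<delta> has_vector_derivative D t) (at t within {a..b}))"
    unfolding eq[symmetric] by (intro exI[of _ D]) simp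
qed

context C1_Banach_manifold
begin

text \<open>\<open>differential_into\<close> takes two-sided derivatives, which may not exist at the
  ends of a piece. Derivatives within [a,b] are meaningful up to the ends, depend continuously on t
  in each chart, and agree with the former inside (\<open>velocity_interior\<close>).\<close>

definition velocity :: "real \<Rightarrow> real \<Rightarrow> (real \<Rightarrow> 'm) \<Rightarrow> real \<Rightarrow> ('m, 'x) tvec" where
  "velocity a b \<gamma> t = (\<lambda>c. if c \<in> A \<and> \<gamma> t \<in> fst c
     then vector_derivative (snd c \<circ> \<gamma>) (at t within {a..b}) else 0)"

lemma C1_path_has_vector_derivative:
  assumes \<gamma>: "C1_path_on A a b \<gamma>" and ab: "a < b" and c: "c \<in> A"
  shows "\<And>t. t \<in> {a..b} \<Longrightarrow> \<gamma> t \<in> fst c \<Longrightarrow>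
      (snd c \<circ> \<gamma> has_vector_derivative velocity a b \<gamma> t c) (at t within {a..b})"
    and "continuous_on {t \<in> {a..b}. \<gamma> t \<in> fst c} (\<lambda>t. velocity a b \<gamma> t c)"
proof -
  obtain D where D: "continuous_on {t \<in> {a..b}. \<gamma> t \<in> fst c} D"
    "\<And>t. t \<in> {a..b} \<Longrightarrow> \<gamma> t \<in> fst c \<Longrightarrow> (snd c \<circ> \<gamma> has_vector_derivative D t) (at t within {a..b})"
    using \<gamma> c unfolding C1_path_on_def by blast
  have eq: "velocity a b \<gamma> t c = D t" if "t \<in> {a..b}" "\<gamma> t \<in> fst c" for t
    using vector_derivative_within_Icc[OF ab that(1) D(2)[OF that]] that c
    by (simp add: velocity_def)
  show "(snd c \<circ> \<gamma> has_vector_derivative velocity a b \<gamma> t c) (at t within {a..b})"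
    if "t \<in> {a..b}" "\<gamma> t \<in> fst c" for t
    using D(2)[OF that] eq[OF that] by simp
  show "continuous_on {t \<in> {a..b}. \<gamma> t \<in> fst c} (\<lambda>t. velocity a b \<gamma> t c)"
    using D(1) by (rule continuous_on_eq) (simp add: eq)
qed

lemma eventually_path:
  assumes "C1_path_on A a b \<gamma>" "t \<in> {a..b}" "open W" "\<gamma> t \<in> W"
  shows "\<forall>\<^sub>F s in at t within {a..b}. \<gamma> s \<in> W"
  using assms unfolding C1_path_on_def continuous_on_def by (metis topological_tendstoD)

text \<open>The path stays in the domain of c near t, so the chain rule with the transition map
  computes every other coordinate from the one in c. This makes the velocity a tangent
  vector.\<close>

lemma velocity_eq_lift:
  assumes \<gamma>: "C1_path_on A a b \<gamma>" and ab: "a < b" and t: "t \<in> {a..b}"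
    and c: "c \<in> A" "\<gamma> t \<in> fst c"
  shows "velocity a b \<gamma> t = lift c (\<gamma> t) (velocity a b \<gamma> t c)"
proof
  fix c'
  show "velocity a b \<gamma> t c' = lift c (\<gamma> t) (velocity a b \<gamma> t c) c'"
  proof (cases "c' \<in> A \<and> \<gamma> t \<in> fst c'")
    case True
    define T where "T = transition_deriv c c' (\<gamma> t)"
    have T: "((snd c' \<circ> chart_inv c) has_derivative T) (at ((snd c \<circ> \<gamma>) t))"
    proof -
      have eq: "(snd c \<circ> \<gamma>) t = snd c (\<gamma> t)" by simp
      show ?thesis
        unfolding T_def eq using True c by (intro transition_has_derivative) auto
    qed
    have "(snd c \<circ> \<gamma> has_derivative (\<lambda>r. r *\<^sub>R velocity a b \<gamma> t c)) (at t within {a..b})"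
      using C1_path_has_vector_derivative(1)[OF \<gamma> ab c(1) t c(2)]
      by (simp add: has_vector_derivative_def)
    from diff_chain_within[OF this has_derivative_at_withinI[OF T]]
    have "((snd c' \<circ> chart_inv c) \<circ> (snd c \<circ> \<gamma>) has_derivative
        (\<lambda>r. r *\<^sub>R T (velocity a b \<gamma> t c))) (at t within {a..b})"
      using linear_scale[OF has_derivative_linear[OF T]] by (simp add: o_def)
    then have "(snd c' \<circ> \<gamma> has_derivative (\<lambda>r. r *\<^sub>R T (velocity a b \<gamma> t c))) (at t within {a..b})"
    proof (rule has_derivative_transform_eventually)
      show "\<forall>\<^sub>F s in at t within {a..b}. (snd c' \<circ> chart_inv c \<circ> (snd c \<circ> \<gamma>)) s = (snd c' \<circ> \<gamma>) s"
        using eventually_path[OF \<gamma> t open_chart_domain[OF c(1)] c(2)]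
        by eventually_elim (simp add: chart_inv_chart c)
    qed (use t c in \<open>simp_all add: chart_inv_chart\<close>)
    then have "vector_derivative (snd c' \<circ> \<gamma>) (at t within {a..b}) = T (velocity a b \<gamma> t c)"
      by (intro vector_derivative_within_Icc[OF ab t]) (simp add: has_vector_derivative_def)
    with True show ?thesis
      unfolding lift_apply[OF c] T_def by (simp add: velocity_def[of a b \<gamma> t, THEN fun_cong, of c'])
  next
    case False
    then show ?thesis by (auto simp: lift_apply[OF c] velocity_def)
  qed
qed

lemma velocity_interior:
  assumes \<gamma>: "C1_path_on A a b \<gamma>" and t: "t \<in> {a<..<b}"
  shows "differential_into A \<gamma> t 1 = velocity a b \<gamma> t"
proof
  fix c
  have t': "t \<in> {a..b}" "a < b" using t by auto
  show "differential_into A \<gamma> t 1 c = velocity a b \<gamma> t c"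
  proof (cases "c \<in> A \<and> \<gamma> t \<in> fst c")
    case True
    have "(snd c \<circ> \<gamma> has_vector_derivative velocity a b \<gamma> t c) (at t within {a..b})"
      using C1_path_has_vector_derivative(1)[OF \<gamma> t'(2) _ t'(1)] True by blast
    then have "(snd c \<circ> \<gamma> has_derivative (\<lambda>r. r *\<^sub>R velocity a b \<gamma> t c)) (at t)"
      using t at_within_Icc_at[of a t b] by (simp add: has_vector_derivative_def)
    from frechet_derivative_at[OF this]
    have "frechet_derivative (snd c \<circ> \<gamma>) (at t) 1 = velocity a b \<gamma> t c"
      by (metis scaleR_one)
    with True show ?thesis by (simp add: differential_into_def)
  next
    case False
    then show ?thesis by (auto simp: differential_into_def velocity_def)
  qed
qed

section \<open>Connecting points by piecewise C^1 paths\<close>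

lemma C1_path_segment:
  assumes c: "c \<in> A" and S: "convex S" "S \<subseteq> snd c ` fst c" and u: "u \<in> S" and w: "w \<in> S"
  shows "C1_path_on A a (a + 1) (\<lambda>t. chart_inv c (u + (t - a) *\<^sub>R (w - u)))"
proof -
  \<comment> \<open>The starting time a is arbitrary, so that the segment can continue a path ending
    at that time.\<close>
  define l where "l t = u + (t - a) *\<^sub>R (w - u)" for t
  have l_S: "l t \<in> S" if "t \<in> {a..a + 1}" for t
    using convexD_alt[OF S(1) u w, of "t - a"] that by (simp add: l_def algebra_simps)
  have l_deriv: "(l has_derivative (\<lambda>r. r *\<^sub>R (w - u))) (at t)" for t
    unfolding l_def[abs_def] by (auto intro!: derivative_eq_intros)
  have l_cont: "continuous_on T l" for T
    unfolding l_def by (intro continuous_intros)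
  have inv: "chart_inv c (l t) \<in> fst c" "snd c (chart_inv c (l t)) = l t" if "t \<in> {a..a + 1}" for t
    using l_S[OF that] S(2) chart_inv_chart[OF c] by auto
  have "continuous_on (snd c ` fst c) (chart_inv c)"
    using chart_homeomorphism[OF c] unfolding homeomorphism_def by simp
  then have "continuous_on {a..a + 1} (\<lambda>t. chart_inv c (l t))"
    by (rule continuous_on_compose2[OF _ l_cont]) (use l_S S(2) in blast)
  moreover have "\<exists>D. continuous_on {t \<in> {a..a + 1}. chart_inv c (l t) \<in> fst c'} D \<and>
      (\<forall>t\<in>{a..a + 1}. chart_inv c (l t) \<in> fst c' \<longrightarrow>
        (snd c' \<circ> (\<lambda>t. chart_inv c (l t)) has_vector_derivative D t) (at t within {a..a + 1}))"
    if c': "c' \<in> A" for c'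
  proof -
    obtain T :: "'x \<Rightarrow> 'x \<Rightarrow>\<^sub>L 'x" where T: "\<And>z. z \<in> snd c ` (fst c \<inter> fst c') \<Longrightarrow>
        (snd c' \<circ> chart_inv c has_derivative blinfun_apply (T z)) (at z)"
      "continuous_on (snd c ` (fst c \<inter> fst c')) T"
      using C1_transition[OF c c'] unfolding C1_on_def by blast
    have dom: "l t \<in> snd c ` (fst c \<inter> fst c')" if "t \<in> {a..a + 1}" "chart_inv c (l t) \<in> fst c'" for t
      using inv[OF that(1)] that(2) by (metis IntI imageI)
    have "continuous_on {t \<in> {a..a + 1}. chart_inv c (l t) \<in> fst c'} (\<lambda>t. T (l t) (w - u))"
      by (intro continuous_intros continuous_on_compose2[OF T(2) l_cont]) (use dom in blast)
    moreover have "(snd c' \<circ> (\<lambda>t. chart_inv c (l t)) has_vector_derivative T (l t) (w - u))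
        (at t within {a..a + 1})" if "t \<in> {a..a + 1}" "chart_inv c (l t) \<in> fst c'" for t
    proof -
      have "((snd c' \<circ> chart_inv c) \<circ> l has_derivative (\<lambda>r. r *\<^sub>R T (l t) (w - u))) (at t)"
        using diff_chain_at[OF l_deriv T(1)[OF dom[OF that]]]
        by (simp add: o_def blinfun.scaleR_right)
      moreover have "(snd c' \<circ> chart_inv c) \<circ> l = snd c' \<circ> (\<lambda>t. chart_inv c (l t))"
        by (simp add: fun_eq_iff)
      ultimately show ?thesis
        unfolding has_vector_derivative_def by (simp only: has_derivative_at_withinI)
    qed
    ultimately show ?thesis by (intro exI[of _ "\<lambda>t. T (l t) (w - u)"]) simp
  qed
  ultimately show ?thesis
    unfolding C1_path_on_def l_def[symmetric] by simp
qed

lemma piecewise_C1_path_append: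
  assumes \<gamma>: "piecewise_C1_path_on A a b \<gamma>" and \<delta>: "C1_path_on A b b' \<delta>"
    and "\<gamma> b = \<delta> b" "b < b'"
  shows "piecewise_C1_path_on A a b' (\<lambda>t. if t \<le> b then \<gamma> t else \<delta> t)"
proof -
  obtain n s where s: "s 0 = a" "s n = b" "\<And>i. i < n \<Longrightarrow> s i < s (Suc i)"
    "\<And>i. i < n \<Longrightarrow> C1_path_on A (s i) (s (Suc i)) \<gamma>"
    using \<gamma> unfolding piecewise_C1_path_on_def by blast
  \<comment> \<open>The old pieces lie to the left of b, where the glued path is \<gamma>.\<close>
  have s_le: "s i \<le> b" if "i \<le> n" for i
    using that s(3) unfolding s(2)[symmetric]
    by (induction rule: inc_induct) (auto intro: order_trans less_imp_le)
  define s' where "s' = s(Suc n := b')"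
  have "s' i < s' (Suc i) \<and> C1_path_on A (s' i) (s' (Suc i)) (\<lambda>t. if t \<le> b then \<gamma> t else \<delta> t)"
    if "i < Suc n" for i
  proof (cases "i = n")
    case True
    have "C1_path_on A b b' (\<lambda>t. if t \<le> b then \<gamma> t else \<delta> t)"
      by (rule C1_path_on_cong[OF \<delta>]) (use assms(3) in auto)
    with True s(2) \<open>b < b'\<close> show ?thesis by (simp add: s'_def)
  next
    case False
    with that have i: "i < n" by simp
    have "C1_path_on A (s i) (s (Suc i)) (\<lambda>t. if t \<le> b then \<gamma> t else \<delta> t)"
      by (rule C1_path_on_cong[OF s(4)[OF i]]) (use s_le[of "Suc i"] i in auto)
    with i s(3)[OF i] show ?thesis by (simp add: s'_def)
  qed
  moreover have "s' 0 = a" "s' (Suc n) = b'" by (simp_all add: s'_def s(1))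
  ultimately show ?thesis
    unfolding piecewise_C1_path_on_def by (intro exI[of _ "Suc n"] exI[of _ s']) simp
qed

text \<open>Serves to show that the set of lengths in \<open>finsler_dist\<close> is nonempty,
  without which its infimum would carry no information.\<close>

definition path_reachable :: "'m \<Rightarrow> 'm set" where
  "path_reachable p = {q. \<exists>a b \<gamma>. a < b \<and> piecewise_C1_path_on A a b \<gamma> \<and> \<gamma> a = p \<and> \<gamma> b = q}"

lemma path_reachable_self: "p \<in> path_reachable p"
proof -
  obtain c where c: "c \<in> A" "p \<in> fst c" using chart_at by blast
  define \<gamma> where "\<gamma> t = chart_inv c (snd c p + (t - 0) *\<^sub>R (snd c p - snd c p))" for t :: real
  have "C1_path_on A 0 1 \<gamma>"
    using C1_path_segment[OF c(1), of "{snd c p}" "snd c p" "snd c p" 0] c(2)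
    by (simp add: \<gamma>_def[abs_def])
  then have "piecewise_C1_path_on A 0 1 \<gamma>"
    unfolding piecewise_C1_path_on_def by (intro exI[of _ 1] exI[of _ real]) simp
  moreover have "\<gamma> t = p" for t using c by (simp add: \<gamma>_def chart_inv_chart)
  ultimately show ?thesis
    unfolding path_reachable_def
    by (intro CollectI exI[of _ "0::real"] exI[of _ "1::real"] exI[of _ \<gamma>]) simp
qed

lemma path_reachable_step:
  assumes q: "q \<in> path_reachable p" and c: "c \<in> A" "q \<in> fst c" "r \<in> fst c"
    and S: "convex S" "S \<subseteq> snd c ` fst c" "snd c q \<in> S" "snd c r \<in> S"
  shows "r \<in> path_reachable p"
proof -
  obtain a b \<gamma> where \<gamma>: "a < b" "piecewise_C1_path_on A a b \<gamma>" "\<gamma> a = p" "\<gamma> b = q"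
    using q unfolding path_reachable_def by blast
  define \<delta> where "\<delta> t = chart_inv c (snd c q + (t - b) *\<^sub>R (snd c r - snd c q))" for t
  have "C1_path_on A b (b + 1) \<delta>"
    unfolding \<delta>_def[abs_def] by (rule C1_path_segment[OF c(1) S])
  moreover have "\<delta> b = q" "\<delta> (b + 1) = r"
    using c by (simp_all add: \<delta>_def chart_inv_chart)
  ultimately have "piecewise_C1_path_on A a (b + 1) (\<lambda>t. if t \<le> b then \<gamma> t else \<delta> t)"
    using \<gamma> by (intro piecewise_C1_path_append) auto
  then show ?thesis
    unfolding path_reachable_def using \<gamma> \<open>\<delta> (b + 1) = r\<close>
    by (intro CollectI exI[of _ a] exI[of _ "b + 1"] exI[of _ "\<lambda>t. if t \<le> b then \<gamma> t else \<delta> t"])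
      simp
qed

text \<open>Within a coordinate ball any two points are joined by a segment, so either all or none
  of its points are reachable. Hence the reachable set and its complement are both open.\<close>

lemma path_reachable_UNIV:
  assumes "connected (UNIV :: 'm set)"
  shows "path_reachable p = UNIV"
proof -
  have nbhd: "\<exists>W. open W \<and> x \<in> W \<and>
      (\<forall>q\<in>W. \<forall>r\<in>W. q \<in> path_reachable p \<longrightarrow> r \<in> path_reachable p)" for x
  proof -
    obtain c where c: "c \<in> A" "x \<in> fst c" using chart_at by blast
    have "open (snd c ` fst c)" using open_chart_image[OF c(1), of UNIV] by simp
    then obtain R where R: "0 < R" "ball (snd c x) R \<subseteq> snd c ` fst c"
      using c(2) open_contains_ball by (metis imageI)
    define W where "W = {y \<in> fst c. snd c y \<in> ball (snd c x) R}"
    have "open W" unfolding W_def by (rule open_chart_preimage[OF c(1) open_ball])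
    moreover have "x \<in> W" using c R by (simp add: W_def)
    moreover have "r \<in> path_reachable p" if "q \<in> W" "r \<in> W" "q \<in> path_reachable p" for q r
      using path_reachable_step[OF that(3) c(1) _ _ convex_ball R(2)] that(1,2)
      unfolding W_def by blast
    ultimately show ?thesis by blast
  qed
  have "open (path_reachable p)"
  proof (rule open_subopen[THEN iffD2], rule ballI)
    fix x assume "x \<in> path_reachable p"
    then show "\<exists>T. open T \<and> x \<in> T \<and> T \<subseteq> path_reachable p" using nbhd[of x] by blast
  qed
  moreover have "open (- path_reachable p)"
  proof (rule open_subopen[THEN iffD2], rule ballI)
    fix x assume "x \<in> - path_reachable p"
    then show "\<exists>T. open T \<and> x \<in> T \<and> T \<subseteq> - path_reachable p" using nbhd[of x] by blast
  qed
  ultimately show ?thesis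
    using connectedD[OF assms, of "path_reachable p" "- path_reachable p"] path_reachable_self[of p]
    by auto
qed

end

section \<open>Speed, length and the increment of f\<close>

context C1_Finsler_manifold
begin

lemma N_lift_continuous:
  assumes "c \<in> A" "x \<in> fst c"
  shows "continuous_on S (\<lambda>v. N x (lift c x v))"
proof -
  obtain a b where b: "0 < b" "\<And>v. N x (lift c x v) \<le> b * norm v"
    using N_lift_bounds[OF assms] by metis
  show ?thesis
  proof (rule continuous_on_if_lipschitz_bound[where C=b])
    fix v w
    show "N x (lift c x v) \<le> N x (lift c x w) + b * norm (v - w)"
      using N_lift_triangle[OF assms, of w "v - w"] b(2)[of "v - w"] by simp
  qed (use b in simp)
qed

text \<open>Both the point and the vector vary. Near t, \<open>P2\<close> places the speed within a
  factor 1 + \<epsilon> of the fixed norm n at \<gamma> t, applied to the coordinate velocity D;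
  there continuity of n and D suffices.\<close>

lemma speed_continuous:
  assumes \<gamma>: "C1_path_on A a b \<gamma>" and ab: "a < b"
  shows "continuous_on {a..b} (\<lambda>t. N (\<gamma> t) (velocity a b \<gamma> t))"
  unfolding continuous_on_def
proof
  fix t assume t: "t \<in> {a..b}"
  obtain c where c: "c \<in> A" "\<gamma> t \<in> fst c" using chart_at by blast
  define n where "n v = N (\<gamma> t) (lift c (\<gamma> t) v)" for v
  define D where "D s = velocity a b \<gamma> s c" for s
  have ev_c: "\<forall>\<^sub>F s in at t within {a..b}. \<gamma> s \<in> fst c"
    by (rule eventually_path[OF \<gamma> t open_chart_domain[OF c(1)] c(2)])
  have "(D \<longlongrightarrow> D t) (at t within {s \<in> {a..b}. \<gamma> s \<in> fst c})"
    using C1_path_has_vector_derivative(2)[OF \<gamma> ab c(1)] t c(2)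
    unfolding continuous_on_def D_def by blast
  \<comment> \<open>The times at which the path is in the chart form a relative neighbourhood of t,
    so restricting to them does not change the limit.\<close>
  moreover have "at t within {s \<in> {a..b}. \<gamma> s \<in> fst c} = at t within {a..b}"
    using ev_c unfolding eventually_at_topological
    by (auto simp: intro!: at_within_nhd)
  ultimately have D: "(D \<longlongrightarrow> D t) (at t within {a..b})" by simp
  have n_cont: "isCont n v" for v
    using N_lift_continuous[OF c, of UNIV] unfolding n_def
    by (simp add: continuous_on_eq_continuous_within)
  have n_lim: "((\<lambda>s. n (D s)) \<longlongrightarrow> n (D t)) (at t within {a..b})"
    by (rule isCont_tendsto_compose[OF n_cont D])
  have speed_lift: "velocity a b \<gamma> s = lift c (\<gamma> s) (D s)" if "s \<in> {a..b}" "\<gamma> s \<in> fst c" for s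
    unfolding D_def by (rule velocity_eq_lift[OF \<gamma> ab that(1) c(1) that(2)])
  have at_t: "N (\<gamma> t) (velocity a b \<gamma> t) = n (D t)"
    unfolding speed_lift[OF t c(2)] n_def ..
  have squeeze: "\<forall>\<^sub>F s in at t within {a..b}.
      1 / (1 + \<epsilon>) * n (D s) \<le> N (\<gamma> s) (velocity a b \<gamma> s) \<and>
      N (\<gamma> s) (velocity a b \<gamma> s) \<le> (1 + \<epsilon>) * n (D s)" if "0 < \<epsilon>" for \<epsilon>
  proof -
    obtain W where W: "open W" "\<gamma> t \<in> W" "W \<subseteq> fst c" "\<And>x v. x \<in> W \<Longrightarrow>
        1 / (1 + \<epsilon>) * N (\<gamma> t) (lift c (\<gamma> t) v) \<le> N x (lift c x v) \<and>
        N x (lift c x v) \<le> (1 + \<epsilon>) * N (\<gamma> t) (lift c (\<gamma> t) v)"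
      using P2[OF \<open>0 < \<epsilon>\<close> c] by blast
    have "\<forall>\<^sub>F s in at t within {a..b}. s \<in> {a..b}"
      by (simp add: eventually_at_filter)
    with eventually_path[OF \<gamma> t W(1,2)] show ?thesis
    proof eventually_elim
      case (elim s)
      then have "\<gamma> s \<in> fst c" using W(3) by blast
      note eq = speed_lift[OF elim(2) this]
      show ?case unfolding eq n_def by (rule W(4)[OF elim(1)])
    qed
  qed
  show "((\<lambda>s. N (\<gamma> s) (velocity a b \<gamma> s)) \<longlongrightarrow> N (\<gamma> t) (velocity a b \<gamma> t)) (at t within {a..b})"
    unfolding at_t
  proof (rule order_tendstoI)
    fix r assume r: "r < n (D t)"
    \<comment> \<open>Choosing \<epsilon> first, by letting it tend to 0, preserves the strict
      inequality with r under the factor.\<close>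
    have "((\<lambda>\<epsilon>. 1 / (1 + \<epsilon>) * n (D t)) \<longlongrightarrow> 1 / (1 + 0) * n (D t)) (at_right (0::real))"
      by (intro tendsto_intros) auto
    then have "\<forall>\<^sub>F \<epsilon> in at_right 0. r < 1 / (1 + \<epsilon>) * n (D t)"
      by (rule order_tendstoD(1)) (simp add: r)
    then have "\<forall>\<^sub>F \<epsilon> in at_right 0. 0 < \<epsilon> \<and> r < 1 / (1 + \<epsilon>) * n (D t)"
      by (intro eventually_conj eventually_at_right_less)
    then obtain \<epsilon> where \<epsilon>: "0 < \<epsilon>" "r < 1 / (1 + \<epsilon>) * n (D t)"
      using eventually_happens'[OF trivial_limit_at_right_real] by blast
    have "((\<lambda>s. 1 / (1 + \<epsilon>) * n (D s)) \<longlongrightarrow> 1 / (1 + \<epsilon>) * n (D t)) (at t within {a..b})"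
      by (intro tendsto_intros n_lim)
    then have "\<forall>\<^sub>F s in at t within {a..b}. r < 1 / (1 + \<epsilon>) * n (D s)"
      by (rule order_tendstoD(1)) (rule \<epsilon>(2))
    with squeeze[OF \<epsilon>(1)] show "\<forall>\<^sub>F s in at t within {a..b}. r < N (\<gamma> s) (velocity a b \<gamma> s)"
      by eventually_elim linarith
  next
    fix r assume r: "n (D t) < r"
    have "((\<lambda>\<epsilon>. (1 + \<epsilon>) * n (D t)) \<longlongrightarrow> (1 + 0) * n (D t)) (at_right (0::real))"
      by (intro tendsto_intros)
    then have "\<forall>\<^sub>F \<epsilon> in at_right 0. (1 + \<epsilon>) * n (D t) < r"
      by (rule order_tendstoD(2)) (simp add: r)
    then have "\<forall>\<^sub>F \<epsilon> in at_right 0. 0 < \<epsilon> \<and> (1 + \<epsilon>) * n (D t) < r"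
      by (intro eventually_conj eventually_at_right_less)
    then obtain \<epsilon> where \<epsilon>: "0 < \<epsilon>" "(1 + \<epsilon>) * n (D t) < r"
      using eventually_happens'[OF trivial_limit_at_right_real] by blast
    have "((\<lambda>s. (1 + \<epsilon>) * n (D s)) \<longlongrightarrow> (1 + \<epsilon>) * n (D t)) (at t within {a..b})"
      by (intro tendsto_intros n_lim)
    then have "\<forall>\<^sub>F s in at t within {a..b}. (1 + \<epsilon>) * n (D s) < r"
      by (rule order_tendstoD(2)) (rule \<epsilon>(2))
    with squeeze[OF \<epsilon>(1)] show "\<forall>\<^sub>F s in at t within {a..b}. N (\<gamma> s) (velocity a b \<gamma> s) < r"
      by eventually_elim linarith
  qed
qed

text \<open>The integrand of \<open>path_len\<close> and the continuous speed differ at most at the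
  two end points, a negligible set.\<close>

lemma path_len_C1:
  assumes \<gamma>: "C1_path_on A a b \<gamma>" and ab: "a < b"
  shows "(\<lambda>t. N (\<gamma> t) (differential_into A \<gamma> t 1)) integrable_on {a..b}"
    and "path_len A N a b \<gamma> = integral {a..b} (\<lambda>t. N (\<gamma> t) (velocity a b \<gamma> t))"
proof -
  have neg: "negligible {a, b}" by simp
  have eq: "N (\<gamma> t) (velocity a b \<gamma> t) = N (\<gamma> t) (differential_into A \<gamma> t 1)"
    if "t \<in> {a..b} - {a, b}" for t
    using velocity_interior[OF \<gamma>, of t] that by auto
  have "(\<lambda>t. N (\<gamma> t) (velocity a b \<gamma> t)) integrable_on {a..b}"
    by (rule integrable_continuous_real[OF speed_continuous[OF \<gamma> ab]])
  then show "(\<lambda>t. N (\<gamma> t) (differential_into A \<gamma> t 1)) integrable_on {a..b}"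
    by (rule integrable_spike[OF _ neg]) (simp only: eq)
  show "path_len A N a b \<gamma> = integral {a..b} (\<lambda>t. N (\<gamma> t) (velocity a b \<gamma> t))"
    unfolding path_len_def by (rule integral_spike[OF neg]) (simp only: eq)
qed

lemma increment_along_path:
  fixes f :: "'m \<Rightarrow> real"
  assumes K: "0 \<le> K"
    and lip: "\<And>c x\<^sub>0 \<epsilon>. c \<in> A \<Longrightarrow> x\<^sub>0 \<in> fst c \<Longrightarrow> 0 < \<epsilon> \<Longrightarrow>
      \<exists>R>0. ball (snd c x\<^sub>0) R \<subseteq> snd c ` fst c \<and>
        (\<forall>u\<in>ball (snd c x\<^sub>0) R. \<forall>w\<in>ball (snd c x\<^sub>0) R. f (chart_inv c u) - f (chart_inv c w)
          \<le> K * (1 + \<epsilon>) * N x\<^sub>0 (lift c x\<^sub>0 (w - u)))"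
    and \<gamma>: "C1_path_on A a b \<gamma>" and ab: "a < b"
    and t: "t \<in> {a..b}" and e: "0 < e"
  shows "\<exists>d>0. \<forall>s\<in>{a..b}. \<bar>s - t\<bar> < d \<longrightarrow>
    \<bar>f (\<gamma> s) - f (\<gamma> t)\<bar> \<le> (K * N (\<gamma> t) (velocity a b \<gamma> t) + e) * \<bar>s - t\<bar>"
proof -
  obtain c where c: "c \<in> A" "\<gamma> t \<in> fst c" using chart_at by blast
  define n where "n v = N (\<gamma> t) (lift c (\<gamma> t) v)" for v
  define D where "D = velocity a b \<gamma> t c"
  have speed: "N (\<gamma> t) (velocity a b \<gamma> t) = n D"
    unfolding n_def D_def by (rule arg_cong[OF velocity_eq_lift[OF \<gamma> ab t c]])
  obtain B where B: "0 < B" "\<And>v. n v \<le> B * norm v"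
    using N_lift_bounds[OF c] unfolding n_def by metis
  have n_scale: "n (r *\<^sub>R v) = \<bar>r\<bar> * n v" for r v
    unfolding n_def by (rule N_lift_scaleR[OF c])
  have n_add: "n (v + w) \<le> n v + n w" for v w
    unfolding n_def by (rule N_lift_triangle[OF c])
  \<comment> \<open>One r controls both errors, the factor 1 + r of the chart estimate and the
    remainder r of the derivative, weighted by the norm constant B.\<close>
  have "((\<lambda>r. K * (1 + r) * (n D + B * r)) \<longlongrightarrow> K * (1 + 0) * (n D + B * 0)) (at_right 0)"
    by (intro tendsto_intros)
  then have "\<forall>\<^sub>F r in at_right 0. K * (1 + r) * (n D + B * r) < K * n D + e"
    by (rule order_tendstoD(2)) (simp add: e)
  then have "\<forall>\<^sub>F r in at_right 0. 0 < r \<and> K * (1 + r) * (n D + B * r) < K * n D + e"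
    by (intro eventually_conj eventually_at_right_less)
  then obtain r where r: "0 < r" "K * (1 + r) * (n D + B * r) < K * n D + e"
    using eventually_happens'[OF trivial_limit_at_right_real] by blast
  obtain R where R: "0 < R" "\<And>u w. u \<in> ball (snd c (\<gamma> t)) R \<Longrightarrow> w \<in> ball (snd c (\<gamma> t)) R \<Longrightarrow>
      f (chart_inv c u) - f (chart_inv c w) \<le> K * (1 + r) * n (w - u)"
    using lip[OF c r(1)] unfolding n_def by blast
  have "(snd c \<circ> \<gamma> has_vector_derivative D) (at t within {a..b})"
    unfolding D_def by (rule C1_path_has_vector_derivative(1)[OF \<gamma> ab c(1) t c(2)])
  then obtain d1 where d1: "0 < d1" "\<And>s. s \<in> {a..b} \<Longrightarrow> \<bar>s - t\<bar> < d1 \<Longrightarrow>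
      norm (snd c (\<gamma> s) - snd c (\<gamma> t) - (s - t) *\<^sub>R D) \<le> r * \<bar>s - t\<bar>"
    using r(1) unfolding has_vector_derivative_def has_derivative_within_alt
    by (auto dest!: spec[of _ r])
  have "\<forall>\<^sub>F s in at t within {a..b}. \<gamma> s \<in> {y \<in> fst c. snd c y \<in> ball (snd c (\<gamma> t)) R}"
    by (rule eventually_path[OF \<gamma> t open_chart_preimage[OF c(1) open_ball]]) (use c R in simp)
  then obtain d2 where d2: "0 < d2" "\<And>s. s \<in> {a..b} \<Longrightarrow> s \<noteq> t \<Longrightarrow> \<bar>s - t\<bar> < d2 \<Longrightarrow>
      \<gamma> s \<in> fst c \<and> snd c (\<gamma> s) \<in> ball (snd c (\<gamma> t)) R"
    unfolding eventually_at dist_real_def by auto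
  have "\<bar>f (\<gamma> s) - f (\<gamma> t)\<bar> \<le> (K * n D + e) * \<bar>s - t\<bar>"
    if s: "s \<in> {a..b}" "\<bar>s - t\<bar> < min d1 d2" for s
  proof (cases "s = t")
    case False
    define u w where "u = snd c (\<gamma> s)" and "w = snd c (\<gamma> t)"
    have s2: "\<gamma> s \<in> fst c" "u \<in> ball w R" using d2(2)[OF s(1) False] s(2) by (auto simp: u_def w_def)
    have inv: "chart_inv c u = \<gamma> s" "chart_inv c w = \<gamma> t"
      unfolding u_def w_def by (rule chart_inv_chart[OF c(1)], fact)+
    have rem: "norm (u - w - (s - t) *\<^sub>R D) \<le> r * \<bar>s - t\<bar>"
      using d1(2)[OF s(1)] s(2) by (simp add: u_def w_def)
    \<comment> \<open>The coordinate increment is the linear part plus the remainder of the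
      derivative at t, estimated separately.\<close>
    have "n (u - w) \<le> n ((s - t) *\<^sub>R D) + n (u - w - (s - t) *\<^sub>R D)"
      using n_add[of "(s - t) *\<^sub>R D" "u - w - (s - t) *\<^sub>R D"] by simp
    also have "n (u - w - (s - t) *\<^sub>R D) \<le> B * (r * \<bar>s - t\<bar>)"
      by (rule order_trans[OF B(2) mult_left_mono[OF rem less_imp_le[OF B(1)]]])
    also have "n ((s - t) *\<^sub>R D) + B * (r * \<bar>s - t\<bar>) = (n D + B * r) * \<bar>s - t\<bar>"
      unfolding n_scale by (simp add: algebra_simps)
    finally have uw: "n (u - w) \<le> (n D + B * r) * \<bar>s - t\<bar>" by simp
    have "n (w - u) = n (u - w)" using n_scale[of "-1" "u - w"] by simp
    moreover have "f (\<gamma> s) - f (\<gamma> t) \<le> K * (1 + r) * n (w - u)"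
      "f (\<gamma> t) - f (\<gamma> s) \<le> K * (1 + r) * n (u - w)"
      using R(2)[of u w] R(2)[of w u] s2(2) R(1) inv by (simp_all add: w_def[symmetric])
    ultimately have "\<bar>f (\<gamma> s) - f (\<gamma> t)\<bar> \<le> K * (1 + r) * n (u - w)" by simp
    also have "\<dots> \<le> K * (1 + r) * ((n D + B * r) * \<bar>s - t\<bar>)"
      using K r(1) uw by (intro mult_left_mono) simp_all
    also have "\<dots> = K * (1 + r) * (n D + B * r) * \<bar>s - t\<bar>" by simp
    also have "\<dots> \<le> (K * n D + e) * \<bar>s - t\<bar>"
      using r(2) by (intro mult_right_mono) simp_all
    finally show ?thesis .
  qed simp
  then show ?thesis
    unfolding speed using d1(1) d2(1) by (intro exI[of _ "min d1 d2"]) simp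
qed

lemma increment_le_path_len:
  fixes f :: "'m \<Rightarrow> real"
  assumes K: "0 \<le> K"
    and lip: "\<And>c x\<^sub>0 \<epsilon>. c \<in> A \<Longrightarrow> x\<^sub>0 \<in> fst c \<Longrightarrow> 0 < \<epsilon> \<Longrightarrow>
      \<exists>R>0. ball (snd c x\<^sub>0) R \<subseteq> snd c ` fst c \<and>
        (\<forall>u\<in>ball (snd c x\<^sub>0) R. \<forall>w\<in>ball (snd c x\<^sub>0) R. f (chart_inv c u) - f (chart_inv c w)
          \<le> K * (1 + \<epsilon>) * N x\<^sub>0 (lift c x\<^sub>0 (w - u)))"
    and \<gamma>: "piecewise_C1_path_on A a b \<gamma>"
  shows "\<bar>f (\<gamma> b) - f (\<gamma> a)\<bar> \<le> K * path_len A N a b \<gamma>"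
proof -
  obtain n s where s: "s 0 = a" "s n = b" "\<And>i. i < n \<Longrightarrow> s i < s (Suc i)"
    "\<And>i. i < n \<Longrightarrow> C1_path_on A (s i) (s (Suc i)) \<gamma>"
    using \<gamma> unfolding piecewise_C1_path_on_def by blast
  define \<iota> where "\<iota> t = N (\<gamma> t) (differential_into A \<gamma> t 1)" for t
  have piece: "\<bar>f (\<gamma> q) - f (\<gamma> p)\<bar> \<le> K * integral {p..q} \<iota>"
    if pq: "p < q" "C1_path_on A p q \<gamma>" for p q
  proof -
    have "\<bar>f (\<gamma> q) - f (\<gamma> p)\<bar> \<le> integral {p..q} (\<lambda>t. K * N (\<gamma> t) (velocity p q \<gamma> t))"
      using pq(1) increment_along_path[OF K lip pq(2,1)]
      by (intro increment_le_integral[of p q _ "\<lambda>t. f (\<gamma> t)"] continuous_on_mult_left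
          speed_continuous pq) auto
    also have "\<dots> = K * path_len A N p q \<gamma>"
      using path_len_C1(2)[OF pq(2,1)] by simp
    finally show ?thesis by (simp add: path_len_def \<iota>_def[abs_def])
  qed
  \<comment> \<open>Integrability is carried along because adding integrals over adjacent intervals
    requires it.\<close>
  have "a \<le> s k \<and> \<iota> integrable_on {a..s k} \<and> \<bar>f (\<gamma> (s k)) - f (\<gamma> a)\<bar> \<le> K * integral {a..s k} \<iota>"
    if "k \<le> n" for k
    using that
  proof (induction k)
    case 0
    then show ?case using s(1) integrable_on_refl[of \<iota> a] by simp
  next
    case (Suc k)
    then have k: "k < n" "a \<le> s k" "\<iota> integrable_on {a..s k}"
      "\<bar>f (\<gamma> (s k)) - f (\<gamma> a)\<bar> \<le> K * integral {a..s k} \<iota>" by auto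
    have "\<iota> integrable_on {s k..s (Suc k)}"
      using path_len_C1(1)[OF s(4)[OF k(1)] s(3)[OF k(1)]] unfolding \<iota>_def[abs_def] .
    then have int: "\<iota> integrable_on {a..s (Suc k)}"
      using k s(3)[OF k(1)] Henstock_Kurzweil_Integration.integrable_combine[of a "s k" "s (Suc k)" \<iota>]
      by simp
    have "integral {a..s k} \<iota> + integral {s k..s (Suc k)} \<iota> = integral {a..s (Suc k)} \<iota>"
      using k s(3)[OF k(1)]
      by (intro Henstock_Kurzweil_Integration.integral_combine int) auto
    then have "K * integral {a..s (Suc k)} \<iota>
        = K * integral {a..s k} \<iota> + K * integral {s k..s (Suc k)} \<iota>"
      by (metis distrib_left)
    then show ?case
      using k int piece[OF s(3)[OF k(1)] s(4)[OF k(1)]] s(3)[OF k(1)] by auto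
  qed
  from this[of n] show ?thesis by (simp add: s(2) path_len_def \<iota>_def[abs_def])
qed

section \<open>The case of negative K\<close>

lemma subdifferential_bound_nonneg:
  fixes v :: 'x
  assumes const: "\<And>x y. f x = (f y :: real)"
    and K: "\<And>x \<xi>. \<xi> \<in> subdifferential A f x \<Longrightarrow> dual_norm A N x \<xi> \<le> K"
    and v: "v \<noteq> 0"
  shows "0 \<le> K"
proof -
  obtain c x where c: "c \<in> A" "x \<in> fst c" using chart_at by blast
  have Z: "C1_function A (\<lambda>_. 0)"
    unfolding C1_function_def o_def using C1_on_const by blast
  \<comment> \<open>For constant f the zero function is a test function everywhere, and its
    differential forces 0 \<le> K once some vector has positive norm.\<close>
  have "differential A (\<lambda>_. 0) x \<in> subdifferential A f x"
    unfolding subdifferential_def using Z const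
    by (intro CollectI exI[of _ "\<lambda>_. 0"]) (auto intro!: always_eventually eq_refl)
  from differential_le_dual_norm[OF Z K[OF this] c, of v]
  have "0 \<le> K * N x (lift c x v)" by linarith
  moreover obtain a where "0 < a" "a * norm v \<le> N x (lift c x v)"
    using N_lift_bounds[OF c] by metis
  then have "0 < N x (lift c x v)"
    using v by (metis less_le_trans mult_pos_pos zero_less_norm_iff)
  ultimately show ?thesis by (simp add: zero_le_mult_iff)
qed

text \<open>Over the zero space there are no unit vectors and \<open>dual_norm\<close> is the unspecified \<open>Sup {}\<close>, so \<open>K\<close>
  may be negative.\<close>

lemma finsler_dist_trivial_model:
  assumes triv: "\<And>v :: 'x. v = 0"
  shows "finsler_dist A N p q = 0"
proof -
  have "N x u = 0" for x u
  proof -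
    obtain c where c: "c \<in> A" "x \<in> fst c" using chart_at by blast
    have "u = lift c x 0"
      by (rule ext) (use triv in metis)
    moreover have "N x (lift c x 0) = 0" using N_lift_scaleR[OF c, of 0 0] by simp
    ultimately show ?thesis by simp
  qed
  then have "path_len A N a b \<gamma> = 0" for a b \<gamma> by (simp add: path_len_def)
  moreover have "q \<in> path_reachable p" using path_reachable_UNIV[OF connected] by simp
  ultimately have "{path_len A N a b \<gamma> | a b \<gamma>.
      a < b \<and> piecewise_C1_path_on A a b \<gamma> \<and> \<gamma> a = p \<and> \<gamma> b = q} = {0}"
    unfolding path_reachable_def by auto
  then show ?thesis unfolding finsler_dist_def by simp
qed

end

section \<open>The global Lipschitz estimate\<close>

theorem theorem2p17:
  fixes A :: "('m::t2_space, 'x::banach) chart set"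
    and N :: "'m \<Rightarrow> ('m, 'x) tvec \<Rightarrow> real"
    and f :: "'m \<Rightarrow> real"
    and K :: real
  assumes "C1_Finsler_manifold A N"
    and "\<exists>b :: 'x \<Rightarrow> real. C1_Lipschitz_bump b"
    and "lower_semicontinuous f"
    and "\<And>x \<xi>. \<xi> \<in> subdifferential A f x \<Longrightarrow> dual_norm A N x \<xi> \<le> K"
  shows "\<forall>y z. \<bar>f y - f z\<bar> \<le> K * finsler_dist A N y z"
proof (intro allI)
  interpret C1_Finsler_manifold A N by (rule assms(1))
  obtain \<beta> :: "'x \<Rightarrow> real" and \<beta>' L where bump: "C1_unit_bump \<beta> \<beta>' L"
    using assms(2) C1_unit_bump_exists by blast
  have len: "\<bar>f (\<gamma> b) - f (\<gamma> a)\<bar> \<le> max K 0 * path_len A N a b \<gamma>"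
    if "piecewise_C1_path_on A a b \<gamma>" for a b \<gamma>
    using locally_Lipschitz_in_chart[OF bump assms(3,4)] that
    by (intro increment_le_path_len) auto
  have lip: "\<bar>f y - f z\<bar> \<le> max K 0 * finsler_dist A N y z" for y z
  proof -
    define S where "S = {path_len A N a b \<gamma> | a b \<gamma>.
      a < b \<and> piecewise_C1_path_on A a b \<gamma> \<and> \<gamma> a = y \<and> \<gamma> b = z}"
    have len_S: "\<bar>f y - f z\<bar> \<le> max K 0 * l" if "l \<in> S" for l
      using that len unfolding S_def by (auto simp: abs_minus_commute)
    have "z \<in> path_reachable y" using path_reachable_UNIV[OF connected] by simp
    then obtain l where l: "l \<in> S" unfolding path_reachable_def S_def by blast
    have "\<bar>f y - f z\<bar> \<le> max K 0 * Inf S"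
    \<comment> \<open>Passing to the infimum requires division by K; otherwise the factor is 0 and
      any single path gives the claim.\<close>
    proof (cases "0 < K")
      case True
      have "\<bar>f y - f z\<bar> / K \<le> Inf S"
        using l len_S True by (intro cInf_greatest) (auto simp: field_simps)
      then show ?thesis using True by (simp add: field_simps)
    next
      case False
      then show ?thesis using len_S[OF l] by simp
    qed
    then show ?thesis unfolding S_def finsler_dist_def .
  qed
  fix y z
  show "\<bar>f y - f z\<bar> \<le> K * finsler_dist A N y z"
  proof (cases "0 \<le> K")
    case True
    then show ?thesis using lip[of y z] by simp
  next
    case False
    \<comment> \<open>With K negative, \<open>max K 0\<close> is 0 and f is constant. A nonzero
      model vector would then give 0 \<le> K, so the model space is trivial and all distances
      vanish.\<close>
    then have const: "f y = f z" for y z using lip[of y z] by simp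
    have "v = 0" for v :: 'x
      using subdifferential_bound_nonneg[where f=f and v=v, OF const assms(4)] False by blast
    then have "finsler_dist A N y z = 0" by (rule finsler_dist_trivial_model)
    then show ?thesis using const[of y z] by simp
  qed
qed

end
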